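(* Let $\rho(f) \in [0,1)$ denote the rotation number of $f: \mathbb{T} \to \mathbb{T}$. (i) If $\rho(f) \not\in \mathbb{Q}$, $f$ is topologically conjugate to the rotation $x \mapsto x + \rho(f) \pmod 1$ on $\mathbb{T}$. In particular $f$ is minimal (all orbits are dense). (ii) If $\rho(f) \in \mathbb{Q}$, write $\rho(f) = p/q$, where, if $\rho(f)>0$, $p,q$ are coprime positive integers, else $p=0,q=1$. There exist two sets $\mathcal{P}^\pm := \bigcup_{i=0}^{q-1} \mathcal{P}_i^\pm$, where the $\mathcal{P}_i^\pm$ are closed intervals. All points in $\mathcal{P}^\pm$ are $q$-periodic and, for all $i \in \mathbb{Z}_q$ and $n \in \mathbb{N}$, $f^n(\mathcal{P}_i^\pm) = \mathcal{P}_{i+pn}^\pm$. All points in $\mathbb{T} \setminus (\mathcal{P}^+ \cup \mathcal{P}^-)$ are non-periodic. Only two possibilities are given: (a) Each $\mathcal{P}_i^\pm$ reduces to a point $x_i^\pm$, ordered according to the orientation of $\mathbb{T}$ as $x_0^- \le x_0^+ \le x_1^- \le x_1^+ \le \cdots \le x_{q-1}^- \le x_{q-1}^+ \le x_0^-$. So $\mathcal{O}^\pm := \{x_0^\pm,\ldots,x_{q-1}^\pm\}$ are two (possibly coinciding) periodic orbits with $f^n(x_i^\pm)=x_{i+pn}^\pm$. For $x\in(x_i^-,x_i^+)$: $f^n(x)\in(x_{i+pn}^-,x_{i+pn}^+)$, $\lim_{n\to+\infty}f^{nq}(x)=x_i^+$, $\lim_{n\to-\infty}f^{nq}(x)=x_i^-$.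 For $x\in(x_i^+,x_{i+1}^-)$: $f^n(x)\in(x_{i+pn}^+,x_{i+1+pn}^-)$, $\lim_{n\to+\infty}f^{nq}(x)=x_i^+$, $\lim_{n\to-\infty}f^{nq}(x)=x_{i+1}^-$. Hence $\mathcal{O}^+$, resp. $\mathcal{O}^-$, is the global attractor, resp. repellor. (b) All $\mathcal{P}_i^\pm$ are non-degenerate intervals with $\mathcal{P}_i^+=\mathcal{P}_i^-=:[x_i^L,x_i^R]$, and $x_0^L < x_0^R \le x_1^L < x_1^R \le \cdots \le x_{q-1}^L < x_{q-1}^R \le x_0^L$, where $x_i^R<x_{i+1}^L$ holds for some $i$ iff it holds for all $i$. (1) If $x_i^R<x_{i+1}^L$ for all $i$, then for $x\in(x_i^R,x_{i+1}^L)$: $f^n(x)\in(x_{i+pn}^R,x_{i+1+pn}^L)$, $\lim_{n\to+\infty}f^{nq}(x)=x_i^R$, $\lim_{n\to-\infty}f^{nq}(x)=x_{i+1}^L$; so $\{x_i^R\}$ and $\{x_i^L\}$ are the unique (not global) attractor and repellor. (2) If $x_i^R=x_{i+1}^L$ for all $i$, all orbits are periodic. If moreover the right side of the table contains no segment (equivalently $b$ is strictly concave), case (b) cannot occur.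
   Context: Setting: an internal-wave billiard (unit-speed point particle in a planar table, reflected so that the angles of incident and reflected velocities with the vertical are equal) in a table $D$ of height $1/2$ with horizontal bases, a vertical left side, and right side the graph of a piecewise $C^1$, strictly decreasing, concave function (possibly plus a vertical segment at its lower end). The dynamics is unfolded to a unit-speed linear flow of direction $\theta\in(\alpha_M,\pi/2)$ on a 4-fold copy $\hat D$ of $D$ whose upper boundary is the graph of an even, piecewise $C^1$, concave function $b:[-1/2,1/2]\to\mathbb{R}^+$ non-increasing on $[0,1/2]$ (lower boundary its mirror image), opposite boundary points identified; $\alpha_M=\arctan b'(-1/2)$. $f$ is the first-return map of this flow to a horizontal cross-section $\Sigma$ of length 1, identified with the circle $\mathbb{T}=\mathbb{R}/\mathbb{Z}$; $f$ is an orientation-preserving homeomorphism. The rotation number is $\rho(f)=\lim_{n\to\infty}(F^n(x)-x)/n \bmod 1$ for a lift $F:\mathbb{R}\to\mathbb{R}$ of $f$. $\mathbb{Z}_q=\mathbb{Z}/q\mathbb{Z}$ denotes cyclic indices (sums of indices taken mod $q$). *)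

theory Defs
  imports "HOL-Analysis.Analysis"
begin

definition circ :: "real \<Rightarrow> complex" where
  "circ t = cis (2 * pi * t)"

abbreviation Tcirc :: "complex set" where
  "Tcirc \<equiv> sphere 0 1"

text \<open>Closed / open positively oriented arcs given by real lifts a \<le> c (with c - a \<le> 1).\<close>
definition carc :: "real \<Rightarrow> real \<Rightarrow> complex set" where
  "carc a c = circ ` {a..c}"

definition oarc :: "real \<Rightarrow> real \<Rightarrow> complex set" where
  "oarc a c = circ ` {a<..<c}"

text \<open>1-periodic extension of the upper boundary b (given on [-1/2,1/2]); the vertical sides
  x = -1/2 and x = 1/2 of the unfolded table are identified, the upper boundary point (x, b x)
  is identified with the lower one (x, - b x).\<close>
definition per_ext :: "(real \<Rightarrow> real) \<Rightarrow> real \<Rightarrow> real" where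
  "per_ext b x = b (x - of_int \<lfloor>x + 1/2\<rfloor>)"

text \<open>Time after which the flow line of direction theta started at (x,0) on Sigma first reaches
  the upper boundary.\<close>
definition hit_time :: "(real \<Rightarrow> real) \<Rightarrow> real \<Rightarrow> real \<Rightarrow> real" where
  "hit_time b \<theta> x = Inf {t. 0 \<le> t \<and> per_ext b (x + t * cos \<theta>) \<le> t * sin \<theta>}"

text \<open>Lift F of the first-return map to Sigma: leave the upper boundary at abscissa X,
  re-enter at (X, - b X) and flow up to height 0.\<close>
definition wave_lift :: "(real \<Rightarrow> real) \<Rightarrow> real \<Rightarrow> real \<Rightarrow> real" where
  "wave_lift b \<theta> x =
     (let X = x + hit_time b \<theta> x * cos \<theta> in X + per_ext b X * cos \<theta> / sin \<theta>)"

definition wave_map :: "(real \<Rightarrow> real) \<Rightarrow> real \<Rightarrow> complex \<Rightarrow> complex" where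
  "wave_map b \<theta> z = circ (wave_lift b \<theta> (Arg z / (2 * pi)))"

definition rot_num :: "(real \<Rightarrow> real) \<Rightarrow> real" where
  "rot_num F = frac (lim (\<lambda>n. ((F ^^ n) 0 - 0) / real n))"

definition strictly_concave_on :: "real set \<Rightarrow> (real \<Rightarrow> real) \<Rightarrow> bool" where
  "strictly_concave_on S g \<longleftrightarrow>
     (\<forall>x\<in>S. \<forall>y\<in>S. \<forall>t. x \<noteq> y \<and> 0 < t \<and> t < 1 \<longrightarrow>
        g (t * x + (1 - t) * y) > t * g x + (1 - t) * g y)"

definition full_orbit :: "(complex \<Rightarrow> complex) \<Rightarrow> complex \<Rightarrow> complex set" where
  "full_orbit f z = {(f ^^ n) z | n. True} \<union> {((inv_into Tcirc f) ^^ n) z | n. True}"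

text \<open>Successor of index i in Z_q on the lifted cyclic chain: for i = q-1 wrap around (+1).\<close>
definition nxt :: "nat \<Rightarrow> (nat \<Rightarrow> real) \<Rightarrow> nat \<Rightarrow> real" where
  "nxt q x i = (if i + 1 < q then x (i + 1) else x 0 + 1)"

definition periodic_structure ::
  "(complex \<Rightarrow> complex) \<Rightarrow> nat \<Rightarrow> nat \<Rightarrow> (nat \<Rightarrow> complex set) \<Rightarrow> (nat \<Rightarrow> complex set) \<Rightarrow> bool" where
  "periodic_structure f p q Pp Pm \<longleftrightarrow>
     (\<forall>i<q. \<forall>z \<in> Pp i \<union> Pm i. (f ^^ q) z = z) \<and>
     (\<forall>i<q. \<forall>n. (f ^^ n) ` Pp i = Pp ((i + p * n) mod q) \<and>
                (f ^^ n) ` Pm i = Pm ((i + p * n) mod q)) \<and>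
     (\<forall>z \<in> Tcirc - ((\<Union>i<q. Pp i) \<union> (\<Union>i<q. Pm i)). \<forall>n>0. (f ^^ n) z \<noteq> z)"

definition gap_dynamics ::
  "(complex \<Rightarrow> complex) \<Rightarrow> nat \<Rightarrow> nat \<Rightarrow> (nat \<Rightarrow> real) \<Rightarrow> (nat \<Rightarrow> real) \<Rightarrow>
   (nat \<Rightarrow> real) \<Rightarrow> (nat \<Rightarrow> real) \<Rightarrow> bool" where
  "gap_dynamics f p q lo hi att rep \<longleftrightarrow>
     (\<forall>i<q. \<forall>z \<in> oarc (lo i) (hi i).
        (\<forall>n. (f ^^ n) z \<in> oarc (lo ((i + p * n) mod q)) (hi ((i + p * n) mod q))) \<and>
        ((\<lambda>n. (f ^^ (n * q)) z) \<longlonglongrightarrow> circ (att i)) \<and>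
        ((\<lambda>n. ((inv_into Tcirc f) ^^ (n * q)) z) \<longlonglongrightarrow> circ (rep i)))"

definition case_a :: "(complex \<Rightarrow> complex) \<Rightarrow> nat \<Rightarrow> nat \<Rightarrow> bool" where
  "case_a f p q \<longleftrightarrow>
     (\<exists>xm xp :: nat \<Rightarrow> real.
        (\<forall>i<q. xm i \<le> xp i \<and> xp i \<le> nxt q xm i) \<and>
        periodic_structure f p q (\<lambda>i. {circ (xp i)}) (\<lambda>i. {circ (xm i)}) \<and>
        gap_dynamics f p q xm xp xp xm \<and>
        gap_dynamics f p q xp (nxt q xm) xp (nxt q xm))"

definition case_b :: "(complex \<Rightarrow> complex) \<Rightarrow> nat \<Rightarrow> nat \<Rightarrow> bool" where
  "case_b f p q \<longleftrightarrow>
     (\<exists>xL xR :: nat \<Rightarrow> real.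
        (\<forall>i<q. xL i < xR i \<and> xR i \<le> nxt q xL i) \<and>
        periodic_structure f p q (\<lambda>i. carc (xL i) (xR i)) (\<lambda>i. carc (xL i) (xR i)) \<and>
        ((\<forall>i<q. xR i < nxt q xL i) \<or> (\<forall>i<q. xR i = nxt q xL i)) \<and>
        ((\<forall>i<q. xR i < nxt q xL i) \<longrightarrow> gap_dynamics f p q xR (nxt q xL) xR (nxt q xL)) \<and>
        ((\<forall>i<q. xR i = nxt q xL i) \<longrightarrow> (\<forall>z\<in>Tcirc. \<exists>n>0. (f ^^ n) z = z)))"

end

theory Submission
  imports Defs
begin

text \<open>
  Let \<open>X\<close> be the abscissa at which a flow line crosses the upper boundary. The return map sends
  \<open>X - b X cot \<theta>\<close> to \<open>X + b X cot \<theta>\<close>. On a period of \<open>b\<close> the former is a convex and the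
  latter a concave function of \<open>X\<close>, and both are increasing because the slope of \<open>b\<close> is below
  \<open>tan \<theta>\<close>. Hence the lift \<open>F\<close> is increasing, bi-Lipschitz and concave on \<open>[a, a + 1]\<close>, with a
  single upward break at \<open>a\<close>.

  If the translation number \<open>\<tau>\<close> is irrational, \<open>h x = sup\<^sub>k (F\<^sup>k x - k \<tau>)\<close> is a monotone
  semiconjugacy to the rotation. An interval on which \<open>h\<close> is constant has pairwise disjoint iterates
  modulo 1, whose lengths therefore tend to 0. Concavity bounds the variation of the logarithmic
  slopes along closest returns, so Denjoy's argument contradicts this.

  If \<open>\<tau> = P/q\<close>, the break points of \<open>F\<^sup>q\<close> are the backward iterates of \<open>a\<close>, and the fixed points
  of \<open>F\<^sup>q - P\<close> are the zeros of a function that is concave between break points. Either \<open>a\<close> is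
  periodic, or each gap of the periodic set around an iterate of \<open>a\<close> contains exactly one break
  point. Either way the zeros in one period are one or two points or an interval.
\<close>

section \<open>Lifts of circle homeomorphisms\<close>

locale circle_lift =
  fixes F :: "real \<Rightarrow> real"
  assumes F_strict_mono: "strict_mono F"
    and F_surj: "surj F"
    and F_shift: "F (x + 1) = F x + 1"
begin

text \<open>One family indexed by \<open>int\<close> has the group law \<open>iter_add\<close>, so
  forward and backward orbits are handled by the same lemmas.\<close>

definition iter :: "int \<Rightarrow> real \<Rightarrow> real" where
  "iter k = (if 0 \<le> k then F ^^ nat k else inv F ^^ nat (- k))"

lemma F_inv [simp]: "F (inv F x) = x"
  using F_surj by (simp add: surj_f_inv_f)

lemma inv_F [simp]: "inv F (F x) = x"
  using F_strict_mono by (simp add: strict_mono_imp_inj_on)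

lemma iter_0 [simp]: "iter 0 x = x"
  by (simp add: iter_def)

lemma iter_nat: "iter (int n) x = (F ^^ n) x"
  by (simp add: iter_def)

lemma iter_neg_nat: "iter (- int n) x = (inv F ^^ n) x"
  by (simp add: iter_def)

lemma iter_Suc: "iter (k + 1) x = F (iter k x)"
proof (cases "0 \<le> k")
  case True
  then show ?thesis by (simp add: iter_def nat_add_distrib)
next
  case False
  then obtain n where n: "k = - int (Suc n)"
    by (metis int_cases linorder_not_less of_nat_0_le_iff)
  then have "iter k x = inv F ((inv F ^^ n) x)" by (simp only: iter_neg_nat) simp
  moreover have "k + 1 = - int n" using n by simp
  ultimately show ?thesis by (simp only: iter_neg_nat F_inv)
qed

lemma iter_pred: "iter (k - 1) x = inv F (iter k x)"
  using iter_Suc[of "k - 1" x] by simp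

lemma iter_add: "iter (j + k) x = iter j (iter k x)"
proof (induction j rule: int_induct[where k = 0])
  case base then show ?case by simp
next
  case (step1 i)
  then show ?case using iter_Suc[of "i + k" x] iter_Suc[of i "iter k x"] by (simp add: ac_simps)
next
  case (step2 i)
  then show ?case using iter_pred[of "i + k" x] iter_pred[of i "iter k x"]
    by (simp add: algebra_simps)
qed

lemma iter_1 [simp]: "iter 1 x = F x"
  using iter_Suc[of 0 x] by simp

lemma F_less_iff [simp]: "F x < F y \<longleftrightarrow> x < y"
  using F_strict_mono by (simp add: strict_mono_less)

lemma inv_F_less_iff [simp]: "inv F x < inv F y \<longleftrightarrow> x < y"
  by (metis F_inv F_less_iff)

lemma iter_less_iff [simp]: "iter k x < iter k y \<longleftrightarrow> x < y"
proof -
  have "(F ^^ n) x < (F ^^ n) y \<longleftrightarrow> x < y" "(inv F ^^ n) x < (inv F ^^ n) y \<longleftrightarrow> x < y" for n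
    by (induction n) auto
  then show ?thesis by (simp add: iter_def)
qed

lemma iter_le_iff [simp]: "iter k x \<le> iter k y \<longleftrightarrow> x \<le> y"
  by (meson iter_less_iff linorder_not_less)

lemma iter_uminus [simp]: "iter k (iter (- k) x) = x" "iter (- k) (iter k x) = x"
  using iter_add[of k "- k" x] iter_add[of "- k" k x] by auto

lemma F_shift_int: "F (x + of_int m) = F x + of_int m"
proof (induction m rule: int_induct[where k = 0])
  case base then show ?case by simp
next
  case (step1 i)
  then show ?case using F_shift[of "x + of_int i"] by (simp add: algebra_simps)
next
  case (step2 i)
  then show ?case using F_shift[of "x + of_int i - 1"] by (simp add: algebra_simps)
qed

lemma inv_F_shift_int: "inv F (x + of_int m) = inv F x + of_int m"
  by (metis F_inv F_shift_int inv_F)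

lemma iter_shift: "iter k (x + of_int m) = iter k x + of_int m"
proof (induction k rule: int_induct[where k = 0])
  case base then show ?case by simp
next
  case (step1 i) then show ?case by (simp add: iter_Suc F_shift_int)
next
  case (step2 i) then show ?case by (simp add: iter_pred inv_F_shift_int)
qed

text \<open>A monotone surjection of the line cannot jump; this is where the continuity of the lift
  comes from.\<close>

lemma continuous_iter: "continuous_on A (iter k)"
proof -
  have "surj (iter k)" by (metis iter_uminus(1) surjI)
  then have "continuous_on UNIV (iter k)"
    by (intro continuous_onI_mono) auto
  then show ?thesis using continuous_on_subset by blast
qed

text \<open>The displacement is 1-periodic, so \<open>y\<close> may be translated into
  \<open>[x, x + 1)\<close>. Monotonicity then puts its image into
  \<open>[iter k x, iter k x + 1)\<close>.\<close>

lemma iter_displacement: "\<bar>(iter k x - x) - (iter k y - y)\<bar> \<le> 1"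
proof -
  define m where "m = - \<lfloor>y - x\<rfloor>"
  have "x \<le> y + of_int m" "y + of_int m < x + of_int 1" unfolding m_def by linarith+
  then have "iter k x \<le> iter k (y + of_int m)" "iter k (y + of_int m) < iter k (x + of_int 1)"
    by (simp_all only: iter_le_iff iter_less_iff)
  with \<open>x \<le> y + of_int m\<close> \<open>y + of_int m < x + of_int 1\<close> show ?thesis
    unfolding iter_shift by simp
qed

section \<open>The translation number: existence and uniform bounds on the deviation\<close>

definition trans_num :: real where
  "trans_num = lim (\<lambda>n. (F ^^ n) 0 / real n)"

text \<open>Cut the orbit segment of length \<open>m * n\<close> into \<open>m\<close> blocks of
  length \<open>n\<close>. By \<open>iter_displacement\<close> each block moves its starting point
  as far as the first block does, up to 1.\<close>

lemma funpow_quasi_linear: "\<bar>(F ^^ (m * n)) 0 - real m * (F ^^ n) 0\<bar> \<le> real m"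
proof (induction m)
  case 0 then show ?case by simp
next
  case (Suc m)
  have "(F ^^ (Suc m * n)) 0 = (F ^^ n) ((F ^^ (m * n)) 0)" by (simp add: funpow_add)
  moreover have "\<bar>((F ^^ n) ((F ^^ (m * n)) 0) - (F ^^ (m * n)) 0) - ((F ^^ n) 0 - 0)\<bar> \<le> 1"
    using iter_displacement[of "int n"] by (simp only: iter_nat)
  ultimately show ?case using Suc.IH by (simp add: algebra_simps abs_le_iff)
qed

text \<open>Both quotients are compared with \<open>(F ^^ (m * n)) 0 / (m * n)\<close>.\<close>

lemma trans_num_Cauchy:
  assumes "0 < m" "0 < n"
  shows "\<bar>(F ^^ m) 0 / real m - (F ^^ n) 0 / real n\<bar> \<le> 1 / real m + 1 / real n"
proof -
  have "\<bar>real m * (F ^^ n) 0 - real n * (F ^^ m) 0\<bar> \<le> real m + real n"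
    using funpow_quasi_linear[of m n] funpow_quasi_linear[of n m] by (simp add: mult.commute)
  then have "\<bar>real m * (F ^^ n) 0 - real n * (F ^^ m) 0\<bar> / (real m * real n)
       \<le> (real m + real n) / (real m * real n)"
    using assms by (intro divide_right_mono) auto
  moreover have "(F ^^ m) 0 / real m - (F ^^ n) 0 / real n
      = - ((real m * (F ^^ n) 0 - real n * (F ^^ m) 0) / (real m * real n))"
    using assms by (simp add: field_simps)
  moreover have "(real m + real n) / (real m * real n) = 1 / real m + 1 / real n"
    using assms by (simp add: field_simps)
  ultimately show ?thesis using assms by (simp add: abs_divide abs_mult)
qed

lemma trans_num_LIMSEQ: "(\<lambda>n. (F ^^ n) 0 / real n) \<longlonglongrightarrow> trans_num"
proof -
  have "Cauchy (\<lambda>n. (F ^^ n) 0 / real n)"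
  proof (rule metric_CauchyI)
    fix e :: real assume "0 < e"
    then obtain N where N: "2 / e < real N" using reals_Archimedean2 by blast
    have pos: "0 < real N" using N \<open>0 < e\<close> by (smt (verit) divide_pos_pos)
    then have b: "1 / real N < e / 2" using N \<open>0 < e\<close> by (simp add: field_simps)
    show "\<exists>M. \<forall>m\<ge>M. \<forall>n\<ge>M. dist ((F ^^ m) 0 / real m) ((F ^^ n) 0 / real n) < e"
    proof (intro exI allI impI)
      fix m n assume "m \<ge> N" "n \<ge> N"
      then have "1 / real m \<le> 1 / real N" "1 / real n \<le> 1 / real N" "0 < m" "0 < n"
        using pos by (auto intro!: divide_left_mono)
      then show "dist ((F ^^ m) 0 / real m) ((F ^^ n) 0 / real n) < e"
        using trans_num_Cauchy[of m n] b unfolding dist_real_def by linarith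
    qed
  qed
  then show ?thesis
    unfolding trans_num_def by (simp add: Cauchy_convergent_iff convergent_LIMSEQ_iff)
qed

text \<open>Let \<open>m\<close> tend to infinity in \<open>trans_num_Cauchy\<close> and multiply by
  \<open>n\<close>.\<close>

lemma funpow_0_bound: "\<bar>(F ^^ n) 0 - real n * trans_num\<bar> \<le> 1"
proof (cases "n = 0")
  case False
  have "(\<lambda>m. \<bar>(F ^^ m) 0 / real m - (F ^^ n) 0 / real n\<bar>)
      \<longlonglongrightarrow> \<bar>trans_num - (F ^^ n) 0 / real n\<bar>"
    by (intro tendsto_intros trans_num_LIMSEQ)
  moreover have "(\<lambda>m. 1 / real m + 1 / real n) \<longlonglongrightarrow> 0 + 1 / real n"
    by (intro tendsto_intros lim_1_over_n)
  moreover have "\<forall>\<^sub>F m in sequentially.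
      \<bar>(F ^^ m) 0 / real m - (F ^^ n) 0 / real n\<bar> \<le> 1 / real m + 1 / real n"
    using eventually_gt_at_top[of 0] by eventually_elim (use False trans_num_Cauchy in auto)
  ultimately have "\<bar>trans_num - (F ^^ n) 0 / real n\<bar> \<le> 0 + 1 / real n"
    by (intro tendsto_le[of sequentially]) auto
  then have "real n * \<bar>trans_num - (F ^^ n) 0 / real n\<bar> \<le> 1"
    using False by (simp add: field_simps)
  then have "\<bar>real n * (trans_num - (F ^^ n) 0 / real n)\<bar> \<le> 1"
    by (simp add: abs_mult)
  then show ?thesis using False by (simp add: right_diff_distrib abs_minus_commute)
qed simp

text \<open>One unit comes from the orbit of 0, the other from changing the base point. A negative
  \<open>k\<close> reduces to \<open>- k\<close> started at \<open>iter k x\<close>.\<close>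

lemma iter_bound: "\<bar>iter k x - x - of_int k * trans_num\<bar> \<le> 2"
proof -
  have pos: "\<bar>iter (int n) y - y - real n * trans_num\<bar> \<le> 2" for n y
    using funpow_0_bound[of n] iter_displacement[of "int n" y 0] by (simp add: iter_nat)
  show ?thesis
  proof (cases "0 \<le> k")
    case True then show ?thesis using pos[of "nat k" x] by simp
  next
    case False then show ?thesis using pos[of "nat (- k)" "iter k x"] by simp
  qed
qed

text \<open>Two different linear rates would drift apart without bound. This computes the
  translation number from a single periodic orbit.\<close>

lemma trans_num_unique:
  assumes "\<And>n::nat. \<bar>iter (int n * k) x - x - real n * c\<bar> \<le> M"
  shows "of_int k * trans_num = c"
proof (rule ccontr)
  assume "of_int k * trans_num \<noteq> c"
  then have "0 < \<bar>of_int k * trans_num - c\<bar>" by simp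
  then obtain n :: nat where n: "M + 2 < real n * \<bar>of_int k * trans_num - c\<bar>"
    using reals_Archimedean3 by blast
  have "real n * \<bar>of_int k * trans_num - c\<bar> = \<bar>real n * (of_int k * trans_num) - real n * c\<bar>"
    by (simp add: abs_mult flip: right_diff_distrib)
  then show False
    using n assms[of n] iter_bound[of "int n * k" x] by (simp add: mult.assoc)
qed

end

section \<open>Denjoy theory for piecewise concave lifts\<close>

text \<open>Both chords are compared with the long chord from \<open>u\<close> to
  \<open>z\<close>.\<close>

lemma concave_on_slope_mono:
  fixes f :: "real \<Rightarrow> real"
  assumes "concave_on I f" "u \<in> I" "z \<in> I" "u < v" "v \<le> w" "w < z"
  shows "(f z - f w) / (z - w) \<le> (f v - f u) / (v - u)"
proof -
  have c: "convex_on I (\<lambda>x. - f x)" using assms(1) by (simp add: concave_on_def)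
  have "(- f u - - f v) / (u - v) \<le> (- f u - - f z) / (u - z)"
    by (rule convex_on_slope_le(1)[OF c]) (use assms in auto)
  also have "\<dots> \<le> (- f w - - f z) / (w - z)"
    by (rule convex_on_slope_le(2)[OF c]) (use assms in auto)
  finally have "(f v - f u) / (u - v) \<le> (f z - f w) / (w - z)" by simp
  moreover have "(f v - f u) / (u - v) = - ((f v - f u) / (v - u))"
    by (metis minus_diff_eq minus_divide_right)
  moreover have "(f z - f w) / (w - z) = - ((f z - f w) / (z - w))"
    by (metis minus_diff_eq minus_divide_right)
  ultimately show ?thesis by linarith
qed

text \<open>The induction adds the intervals in the order of their midpoints. The last one is
  rightmost, so the others lie in \<open>[c, A x]\<close>, which is why \<open>d\<close> must vary.
  It serves both for lengths of iterates and for ranges of logarithmic slopes.\<close>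

lemma sum_nonoverlapping_le:
  fixes A B :: "'i \<Rightarrow> real"
  assumes "finite I" "c \<le> d"
    and "\<And>i. i \<in> I \<Longrightarrow> c \<le> A i \<and> A i \<le> B i \<and> B i \<le> d"
    and "\<And>i j. i \<in> I \<Longrightarrow> j \<in> I \<Longrightarrow> i \<noteq> j \<Longrightarrow> B i \<le> A j \<or> B j \<le> A i"
  shows "(\<Sum>i\<in>I. B i - A i) \<le> d - c"
  using assms
proof (induction I arbitrary: d rule: finite_ranking_induct[where f = "\<lambda>i. A i + B i"])
  case empty then show ?case by simp
next
  case (insert x S)
  show ?case
  proof (cases "x \<in> S")
    case True
    then have "insert x S = S" by blast
    then show ?thesis using insert by (metis (full_types))
  next
    case False
    have le: "B y \<le> A x" if "y \<in> S" for y
      using insert.hyps(2)[OF that] insert.prems(2)[of x] insert.prems(2)[of y]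
        insert.prems(3)[of x y] that False by (smt (verit) insertCI)
    have "(\<Sum>i\<in>S. B i - A i) \<le> A x - c"
      by (rule insert.IH) (use insert.prems le in auto)
    then show ?thesis using insert.prems(2)[of x] insert.hyps(1) False by simp
  qed
qed

text \<open>Closest returns of the rotation exist at arbitrarily late times: take the first time
  \<open>q\<close> at which the distance to the integers drops below all distances reached up to a
  given time.\<close>

lemma record_approximation:
  fixes \<tau> :: real and N :: nat
  assumes "\<tau> \<notin> \<rat>"
  obtains q :: nat and n :: int where "N < q"
    "\<And>j m. 0 < j \<Longrightarrow> j < q \<Longrightarrow> \<bar>real q * \<tau> - of_int n\<bar> < \<bar>real j * \<tau> - of_int m\<bar>"
proof -
  define dn where "dn j = \<bar>real j * \<tau> - of_int (round (real j * \<tau>))\<bar>" for j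
  have dn_pos: "0 < dn j" if "0 < j" for j
  proof (rule ccontr)
    assume "\<not> 0 < dn j"
    then have "\<tau> = of_int (round (real j * \<tau>)) / of_nat j"
      using that by (simp add: dn_def field_simps)
    then show False using assms by (metis Rats_divide Rats_of_int Rats_of_nat)
  qed
  have dn_le: "dn j \<le> \<bar>real j * \<tau> - of_int m\<bar>" for j m
    unfolding dn_def using round_diff_minimal by blast
  \<comment> \<open>The bound \<open>Suc N\<close> keeps the set nonempty when
    \<open>N = 0\<close>.\<close>
  define \<mu> where "\<mu> = Min (dn ` {1..Suc N})"
  have "0 < \<mu>" unfolding \<mu>_def using dn_pos by (subst Min_gr_iff) auto
  then obtain k where "0 < k" "\<bar>frac (real k * \<tau>) - 0\<bar> < \<mu>"
    using Kronecker_approx_1_explicit[OF assms, of 0 \<mu>] by auto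
  then have "0 < k \<and> dn k < \<mu>"
    using dn_le[of k "\<lfloor>real k * \<tau>\<rfloor>"] by (simp add: frac_def)
  then obtain q where q: "0 < q" "dn q < \<mu>" "\<And>j. j < q \<Longrightarrow> \<not> (0 < j \<and> dn j < \<mu>)"
    using exists_least_iff[of "\<lambda>k. 0 < k \<and> dn k < \<mu>"] by blast
  have "N < q"
  proof (rule ccontr)
    assume "\<not> N < q"
    then have "\<mu> \<le> dn q" unfolding \<mu>_def using q(1) by (intro Min_le) auto
    then show False using q(2) by simp
  qed
  moreover have "\<bar>real q * \<tau> - of_int (round (real q * \<tau>))\<bar> < \<bar>real j * \<tau> - of_int m\<bar>"
    if "0 < j" "j < q" for j m
    using q(2) q(3)[OF that(2)] that(1) dn_le[of j m] unfolding dn_def[of q, symmetric] by linarith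
  ultimately show ?thesis using that by blast
qed

text \<open>The slope bounds keep logarithms of chord slopes in a fixed interval. By periodicity,
  concavity on one period can fail only across the translates of \<open>a\<close>, the break
  points.\<close>

locale concave_lift = circle_lift +
  fixes a K :: real
  assumes K_pos: "0 < K"
    and F_slope_ge: "x < y \<Longrightarrow> (y - x) / K \<le> F y - F x"
    and F_slope_le: "x < y \<Longrightarrow> F y - F x \<le> K * (y - x)"
    and F_concave: "concave_on {a..a + 1} F"
begin

text \<open>If \<open>h\<close> were constant on \<open>[u, v]\<close>, the iterates of this
  interval would be pairwise disjoint modulo 1 and their forward lengths would tend to 0. Along
  closest returns \<open>q\<close>, however, the product of the lengths of the iterates
  \<open>q\<close> and \<open>- q\<close> stays above a positive constant.\<close>

lemma no_wandering_interval:
  fixes h :: "real \<Rightarrow> real"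
  assumes irr: "\<tau> \<notin> \<rat>" and h_mono: "mono h"
    and h_iter: "\<And>k x m. h (iter k x + of_int m) = h x + of_int k * \<tau> + of_int m"
    and "u < v"
  shows "h u \<noteq> h v"
proof
  assume huv: "h u = h v"
  define U where "U k m = iter k u + of_int m" for k m
  define V where "V k m = iter k v + of_int m" for k m
  define len where "len k = iter k v - iter k u" for k
  have UV: "V k m - U k m = len k" for k m by (simp add: U_def V_def len_def)
  have len_pos: "0 < len k" for k using \<open>u < v\<close> by (simp add: len_def)
  have UltV: "U k m < V k m" for k m using UV[of k m] len_pos[of k] by linarith
  \<comment> \<open>The translated iterates are ordered on the line exactly as the values
    \<open>k \<tau> + m\<close> of the rotation.\<close>
  have sep: "V k m < U k' m'" if "of_int k * \<tau> + of_int m < of_int k' * \<tau> + of_int m'" for k m k' m'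
  proof -
    have "h (V k m) < h (U k' m')" using that huv by (simp add: U_def V_def h_iter)
    then show ?thesis using h_mono by (metis linorder_not_less monoD)
  qed
  have len_lt_1: "len k < 1" for k
    using sep[of k 0 k 1] by (simp add: U_def V_def len_def)
  have irr': "of_int k * \<tau> \<noteq> of_int m" if "k \<noteq> 0" for k m :: int
  proof
    assume "of_int k * \<tau> = of_int m"
    then have "\<tau> = of_int m / of_int k" using that by (simp add: field_simps)
    then show False using irr by (metis Rats_divide Rats_of_int)
  qed
  \<comment> \<open>Translated so as to start in \<open>[0, 1)\<close>, the iterates are disjoint
    subintervals of \<open>[0, 2]\<close>, so their lengths are summable.\<close>
  have len_0: "(\<lambda>n. len (int n)) \<longlonglongrightarrow> 0"
  proof (rule summable_LIMSEQ_zero, rule summableI_nonneg_bounded)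
    fix N :: nat
    define m where "m k = - \<lfloor>iter (int k) u\<rfloor>" for k
    have rng: "0 \<le> U (int k) (m k) \<and> U (int k) (m k) \<le> V (int k) (m k) \<and> V (int k) (m k) \<le> 2" for k
      using UltV[of "int k" "m k"] len_lt_1[of "int k"] UV[of "int k" "m k"]
      unfolding U_def m_def by (simp add: algebra_simps) linarith
    have "(\<Sum>k\<in>{..<N}. V (int k) (m k) - U (int k) (m k)) \<le> 2 - 0"
    proof (rule sum_nonoverlapping_le)
      fix i j :: nat assume "i \<noteq> j"
      then have "of_int (int i) * \<tau> + of_int (m i) \<noteq> of_int (int j) * \<tau> + of_int (m j)"
        using irr'[of "int i - int j" "m j - m i"] by (simp add: algebra_simps)
      then show "V (int i) (m i) \<le> U (int j) (m j) \<or> V (int j) (m j) \<le> U (int i) (m i)"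
        by (meson less_imp_le linorder_neq_iff sep)
    qed (use rng in auto)
    then show "(\<Sum>k<N. len (int k)) \<le> 2" by (simp add: UV)
  qed (use len_pos less_imp_le in blast)
  \<comment> \<open>The logarithm of the chord slope of \<open>F\<close> over the
    \<open>k\<close>-th iterate; its sums telescope to logarithms of lengths.\<close>
  define S where "S k = ln (len (k + 1) / len k)" for k
  define \<kappa> where "\<kappa> = ln K"
  have slope: "(F (V k m) - F (U k m)) / (V k m - U k m) = len (k + 1) / len k" for k m
    by (simp add: U_def V_def len_def F_shift_int iter_Suc)
  have S_bound: "\<bar>S k\<bar> \<le> \<kappa>" for k
  proof -
    have "iter k u < iter k v" using \<open>u < v\<close> by simp
    then have "len k / K \<le> len (k + 1)" "len (k + 1) \<le> K * len k"
      using F_slope_ge F_slope_le unfolding len_def iter_Suc by blast+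
    then have "1 / K \<le> len (k + 1) / len k" "len (k + 1) / len k \<le> K"
      using len_pos[of k] K_pos by (simp_all add: field_simps)
    then have "ln (1 / K) \<le> S k" "S k \<le> \<kappa>" unfolding S_def \<kappa>_def
      using K_pos len_pos by (smt (verit) divide_pos_pos ln_mono)+
    then show ?thesis using K_pos by (simp add: \<kappa>_def ln_div)
  qed
  have S_anti: "S k' \<le> S k" if "a \<le> U k m" "V k m \<le> U k' m'" "V k' m' \<le> a + 1" for k m k' m'
  proof -
    have "(F (V k' m') - F (U k' m')) / (V k' m' - U k' m')
        \<le> (F (V k m) - F (U k m)) / (V k m - U k m)"
      by (rule concave_on_slope_mono[OF F_concave])
         (use that UltV[of k m] UltV[of k' m'] in auto)
    then show ?thesis unfolding slope S_def using len_pos by (intro ln_mono) auto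
  qed
  \<comment> \<open>The sum of \<open>S (k - q) - S k\<close> over \<open>k < q\<close> telescopes
    to \<open>2 ln (len 0) - ln (len q) - ln (len (- q))\<close>. The claim amounts to bounding it
    by \<open>4 \<kappa>\<close> independently of \<open>q\<close>.\<close>
  have returns: "2 * ln (len 0) - 4 * \<kappa> \<le> ln (len (int q)) + ln (len (- int q))"
    if rec: "\<And>j m. 0 < j \<Longrightarrow> j < q \<Longrightarrow> \<bar>real q * \<tau> - of_int n\<bar> < \<bar>real j * \<tau> - of_int m\<bar>"
    for q :: nat and n :: int
  proof -
    \<comment> \<open>The hulls \<open>[lo k, hi k]\<close> of an iterate and its closest return are disjoint modulo 1, and at most
      one of them contains the break point.\<close>
    define lo where "lo k = min (U (int k) 0) (U (int k - int q) n)" for k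
    define hi where "hi k = max (V (int k) 0) (V (int k - int q) n)" for k
    have disj: "hi k + of_int m < lo l \<or> hi l < lo k + of_int m" if kl: "k < q" "l < q" "k \<noteq> l" for k l m
    proof -
      \<comment> \<open>\<open>y\<close> separates the indices \<open>k\<close> and \<open>l\<close>
        under the rotation. The record property makes it larger in modulus than the return distance,
        so all four pairs of intervals are ordered by the sign of \<open>y\<close>.\<close>
      define y where "y = (real k - real l) * \<tau> + of_int m"
      have big: "\<bar>real q * \<tau> - of_int n\<bar> < \<bar>y\<bar>"
      proof (cases "l < k")
        case True
        then show ?thesis using rec[of "k - l" "- m"] kl by (simp add: y_def of_nat_diff)
      next
        case False
        then have "\<bar>real q * \<tau> - of_int n\<bar> < \<bar>- y\<bar>"
          using rec[of "l - k" m] kl by (simp add: y_def of_nat_diff algebra_simps)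
        then show ?thesis by simp
      qed
      have sh: "U i j + of_int m = U i (j + m)" "V i j + of_int m = V i (j + m)" for i j
        by (simp_all add: U_def V_def)
      show ?thesis
      proof (cases "y < 0")
        case True
        then have "V (int k) m < U (int l) 0" "V (int k) m < U (int l - int q) n"
          "V (int k - int q) (n + m) < U (int l) 0" "V (int k - int q) (n + m) < U (int l - int q) n"
          using big by (auto intro!: sep simp: y_def algebra_simps abs_less_iff abs_if split: if_splits)
        then show ?thesis by (simp add: hi_def lo_def sh max_add_distrib_left)
      next
        case False
        then have "V (int l) 0 < U (int k) m" "V (int l - int q) n < U (int k) m"
          "V (int l) 0 < U (int k - int q) (n + m)" "V (int l - int q) n < U (int k - int q) (n + m)"
          using big by (auto intro!: sep simp: y_def algebra_simps abs_less_iff abs_if split: if_splits)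
        then show ?thesis by (simp add: hi_def lo_def sh min_add_distrib_left)
      qed
    qed
    \<comment> \<open>Indices whose hull contains a break point. Disjointness modulo 1 leaves at
      most one, and its term costs at most \<open>2 \<kappa>\<close>.\<close>
    define E where "E = {k. k < q \<and> (\<exists>m::int. lo k < a + of_int m \<and> a + of_int m < hi k)}"
    have "k = l" if kl: "k \<in> E" "l \<in> E" for k l
    proof (rule ccontr)
      assume "k \<noteq> l"
      obtain m m' :: int where m: "lo k < a + of_int m" "a + of_int m < hi k"
        "lo l < a + of_int m'" "a + of_int m' < hi l" "k < q" "l < q"
        using kl unfolding E_def by blast
      then show False using disj[OF m(5,6) \<open>k \<noteq> l\<close>, of "m' - m"] by auto
    qed
    then have cardE: "card E \<le> 1" by (metis card_le_Suc0_iff_eq One_nat_def card.infinite le0)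
    have finE: "finite E" unfolding E_def by simp
    define D where "D k = \<bar>S (int k) - S (int k - int q)\<bar>" for k
    have D_le: "D k \<le> 2 * \<kappa>" for k
      using S_bound[of "int k"] S_bound[of "int k - int q"] by (simp add: D_def)
    have kappa0: "0 \<le> \<kappa>" using S_bound[of 0] by linarith
    have "(\<Sum>k\<in>E. D k) \<le> real (card E) * (2 * \<kappa>)"
      by (intro sum_bounded_above) (use D_le in auto)
    also have "\<dots> \<le> 1 * (2 * \<kappa>)" using cardE kappa0 by (intro mult_right_mono) auto
    finally have sumE: "(\<Sum>k\<in>E. D k) \<le> 2 * \<kappa>" by simp
    \<comment> \<open>\<open>[A k, B k]\<close> is the range between the two negated logarithmic
      slopes. By concavity negated slopes increase from left to right within a period, so hulls in
      disjoint position give nonoverlapping ranges inside \<open>[- \<kappa>, \<kappa>]\<close>, of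
      total length at most \<open>2 \<kappa>\<close>.\<close>
    define A where "A k = min (- S (int k)) (- S (int k - int q))" for k
    define B where "B k = max (- S (int k)) (- S (int k - int q))" for k
    have "(\<Sum>k\<in>{..<q} - E. B k - A k) \<le> \<kappa> - (- \<kappa>)"
    proof (rule sum_nonoverlapping_le)
      fix k assume "k \<in> {..<q} - E"
      show "- \<kappa> \<le> A k \<and> A k \<le> B k \<and> B k \<le> \<kappa>"
        using S_bound[of "int k"] S_bound[of "int k - int q"] by (auto simp: A_def B_def)
    next
      fix k l assume kl: "k \<in> {..<q} - E" "l \<in> {..<q} - E" "k \<noteq> l"
      have norm: "\<exists>m::int. a \<le> lo j + of_int m \<and> hi j + of_int m \<le> a + 1" if "j \<in> {..<q} - E" for j
      proof (intro exI conjI)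
        define m where "m = \<lfloor>lo j - a\<rfloor>"
        show "a \<le> lo j + of_int (- \<lfloor>lo j - a\<rfloor>)" by (simp add: algebra_simps) linarith
        show "hi j + of_int (- \<lfloor>lo j - a\<rfloor>) \<le> a + 1"
        proof (rule ccontr)
          assume "\<not> ?thesis"
          then have "lo j < a + of_int (m + 1)" "a + of_int (m + 1) < hi j"
            unfolding m_def by (simp_all add: algebra_simps) linarith
          then show False using that unfolding E_def by blast
        qed
      qed
      have ord: "B k \<le> A l" if k: "a \<le> lo k + of_int m" and l: "hi l + of_int m' \<le> a + 1"
        and "hi k + of_int m < lo l + of_int m'" for k l and m m' :: int
      proof -
        have sh: "U i j + of_int m = U i (j + m)" "V i j + of_int m = V i (j + m)" for i j m
          by (simp_all add: U_def V_def)
        have "a \<le> U (int k) m" "a \<le> U (int k - int q) (n + m)"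
          "V (int l) m' \<le> a + 1" "V (int l - int q) (n + m') \<le> a + 1"
          "V (int k) m \<le> U (int l) m'" "V (int k) m \<le> U (int l - int q) (n + m')"
          "V (int k - int q) (n + m) \<le> U (int l) m'"
          "V (int k - int q) (n + m) \<le> U (int l - int q) (n + m')"
          using that unfolding lo_def hi_def by (simp_all add: min_add_distrib_left max_add_distrib_left sh)
        then have "S (int l) \<le> S (int k)" "S (int l - int q) \<le> S (int k)"
          "S (int l) \<le> S (int k - int q)" "S (int l - int q) \<le> S (int k - int q)"
          by (blast intro: S_anti)+
        then show ?thesis by (simp add: A_def B_def)
      qed
      obtain m m' :: int where m: "a \<le> lo k + of_int m" "hi k + of_int m \<le> a + 1"
        "a \<le> lo l + of_int m'" "hi l + of_int m' \<le> a + 1"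
        using norm[OF kl(1)] norm[OF kl(2)] by blast
      have "hi k + of_int (m - m') < lo l \<or> hi l < lo k + of_int (m - m')"
        using disj[of k l "m - m'"] kl by auto
      then show "B k \<le> A l \<or> B l \<le> A k"
        using ord[OF m(1,4)] ord[OF m(3,2)] by auto
    qed (use kappa0 in auto)
    moreover have "D k = B k - A k" for k by (simp add: D_def A_def B_def)
    ultimately have sumN: "(\<Sum>k\<in>{..<q} - E. D k) \<le> 2 * \<kappa>" by simp
    have "(\<Sum>k<q. D k) = (\<Sum>k\<in>{..<q} - E. D k) + (\<Sum>k\<in>E. D k)"
      by (intro sum.subset_diff) (auto simp: E_def)
    then have sumD: "(\<Sum>k<q. D k) \<le> 4 * \<kappa>" using sumE sumN by simp
    have S_diff: "S k = ln (len (k + 1)) - ln (len k)" for k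
      using len_pos[of k] len_pos[of "k + 1"] by (simp add: S_def ln_div)
    have "(\<Sum>k<q. S (int k)) = ln (len (int q)) - ln (len 0)"
      using sum_lessThan_telescope[of "\<lambda>k. ln (len (int k))" q]
      by (simp add: S_diff add.commute)
    moreover have "(\<Sum>k<q. S (int k - int q)) = ln (len 0) - ln (len (- int q))"
      using sum_lessThan_telescope[of "\<lambda>k. ln (len (int k - int q))" q]
      by (simp add: S_diff algebra_simps)
    moreover have "(\<Sum>k<q. S (int k - int q)) - (\<Sum>k<q. S (int k)) \<le> (\<Sum>k<q. D k)"
      unfolding sum_subtractf[symmetric] by (intro sum_mono) (simp add: D_def)
    ultimately show ?thesis using sumD by linarith
  qed
  \<comment> \<open>Beyond \<open>N\<close> the forward lengths alone violate
    \<open>returns\<close>, because \<open>len (- q) < 1\<close> makes the other logarithm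
    negative.\<close>
  have "\<forall>\<^sub>F n in sequentially. len (int n) < exp (2 * ln (len 0) - 4 * \<kappa>)"
    using order_tendstoD(2)[OF len_0] by simp
  then obtain N where N: "\<And>n. n \<ge> N \<Longrightarrow> len (int n) < exp (2 * ln (len 0) - 4 * \<kappa>)"
    by (auto simp: eventually_sequentially)
  obtain q n where q: "N < q"
    "\<And>j m. 0 < j \<Longrightarrow> j < q \<Longrightarrow> \<bar>real q * \<tau> - of_int n\<bar> < \<bar>real j * \<tau> - of_int m\<bar>"
    using record_approximation[OF irr] by metis
  have "ln (len (int q)) < ln (exp (2 * ln (len 0) - 4 * \<kappa>))"
    using N[of q] q(1) len_pos by (subst ln_less_cancel_iff) auto
  moreover have "ln (len (- int q)) < 0" using len_pos len_lt_1 by simp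
  ultimately show False using returns[OF q(2)] by simp
qed

end

section \<open>Irrational rotation number\<close>

lemma circ_eq_iff: "circ x = circ y \<longleftrightarrow> (\<exists>m::int. x = y + of_int m)"
proof -
  have "circ x = circ y \<longleftrightarrow>
      (\<exists>n::int. \<i> * of_real (2 * pi * x) = \<i> * of_real (2 * pi * y) + of_int (2 * n) * pi * \<i>)"
    by (simp add: circ_def cis_conv_exp exp_eq)
  also have "\<dots> \<longleftrightarrow> (\<exists>n::int. 2 * pi * x = 2 * pi * (y + of_int n))"
    by (simp add: complex_eq_iff algebra_simps)
  finally show ?thesis by simp
qed

lemma circ_shift [simp]: "circ (x + of_int m) = circ x"
  by (auto simp: circ_eq_iff)

lemma circ_diff_int [simp]: "circ (x - of_int m) = circ x"
  using circ_shift[of x "- m"] by simp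

lemma circ_add: "circ (x + y) = circ x * circ y"
  by (simp add: circ_def cis_mult ring_distribs)

lemma norm_circ [simp]: "cmod (circ x) = 1"
  by (simp add: circ_def)

lemma circ_in_Tcirc: "circ x \<in> Tcirc"
  by simp

lemma circ_Arg: "z \<in> Tcirc \<Longrightarrow> circ (Arg z / (2 * pi)) = z"
  by (cases "z = 0") (auto simp: circ_def cis_Arg sgn_eq)

lemma Tcirc_eq: "Tcirc = range circ"
proof
  show "Tcirc \<subseteq> range circ" using circ_Arg by (metis rangeI subsetI)
qed auto

lemma Tcirc_cases:
  assumes "z \<in> Tcirc" obtains x where "z = circ x"
  using assms by (metis circ_Arg)

lemma continuous_circ: "continuous_on A circ"
  unfolding circ_def by (intro continuous_intros)

lemma tendsto_circ: "(g \<longlongrightarrow> l) G \<Longrightarrow> ((\<lambda>x. circ (g x)) \<longlongrightarrow> circ l) G"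
  by (rule continuous_on_tendsto_compose[OF continuous_circ[of UNIV]]) auto

text \<open>Kronecker approximation of the midpoint of \<open>(y, z)\<close> modulo 1, within half
  the length of the interval.\<close>

lemma dense_irrational_multiples:
  fixes \<tau> :: real
  assumes "\<tau> \<notin> \<rat>" "y < z"
  obtains n :: nat and m :: int where "y < real n * \<tau> + of_int m" "real n * \<tau> + of_int m < z"
proof -
  define \<alpha> where "\<alpha> = frac ((y + z) / 2)"
  obtain k where k: "0 < k" "\<bar>frac (real k * \<tau>) - \<alpha>\<bar> < (z - y) / 2"
    using Kronecker_approx_1_explicit[OF assms(1), of \<alpha> "(z - y) / 2"] assms(2)
    by (auto simp: \<alpha>_def frac_lt_1 less_imp_le)
  show thesis
    by (rule that[of k "\<lfloor>(y + z) / 2\<rfloor> - \<lfloor>real k * \<tau>\<rfloor>"])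
       (use k(2) in \<open>simp_all add: \<alpha>_def frac_def abs_less_iff field_simps\<close>)
qed

text \<open>Near \<open>z\<close> the covering has the local inverse \<open>l\<close>. Rotating
  \<open>z\<close> to 1 before taking \<open>Arg\<close> keeps it away from the branch cut.\<close>

lemma continuous_on_circ_lift:
  assumes h: "continuous_on UNIV h" and H: "\<And>x. H (circ x) = circ (h x)"
  shows "continuous_on Tcirc H"
  unfolding continuous_on_eq_continuous_within
proof
  fix z assume "z \<in> Tcirc"
  then obtain x where z: "z = circ x" by (rule Tcirc_cases)
  define l where "l w = x + Arg (w * circ (- x)) / (2 * pi)" for w
  have one: "circ x * circ (- x) = 1" by (simp add: circ_def cis_mult)
  have cl: "circ (l w) = w" if "w \<in> Tcirc" for w
  proof -
    have "w * circ (- x) \<in> Tcirc" using that by (simp add: norm_mult circ_def)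
    then have "circ (l w) = w * (circ x * circ (- x))"
      unfolding l_def circ_add by (subst circ_Arg) (simp_all only: ac_simps)
    then show ?thesis by (simp add: one)
  qed
  have "isCont (\<lambda>w. circ (h (l w))) z"
  proof -
    have "isCont (\<lambda>w. Arg (w * circ (- x))) z"
      by (rule isCont_o2[where g = Arg], intro continuous_intros)
         (simp add: z one continuous_at_Arg)
    then have "isCont l z" unfolding l_def by (intro continuous_intros) auto
    then have "isCont (\<lambda>w. h (l w)) z"
      by (rule isCont_o2) (use h continuous_on_eq_continuous_at[OF open_UNIV] in blast)
    then show ?thesis
      by (rule isCont_o2)
         (use continuous_circ[of UNIV] continuous_on_eq_continuous_at[OF open_UNIV] in blast)
  qed
  then have "continuous (at z within Tcirc) (\<lambda>w. circ (h (l w)))"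
    using continuous_at_imp_continuous_within by blast
  then show "continuous (at z within Tcirc) H"
    by (rule continuous_transform_within[where \<delta> = 1])
       (use \<open>z \<in> Tcirc\<close> cl in \<open>simp_all flip: H\<close>)
qed

locale circle_map = circle_lift +
  fixes f :: "complex \<Rightarrow> complex"
  assumes f_circ: "f (circ x) = circ (F x)"
begin

lemma funpow_circ: "(f ^^ n) (circ x) = circ (iter (int n) x)"
  unfolding iter_nat by (induction n) (simp_all add: f_circ)

lemma inj_on_f: "inj_on f Tcirc"
proof
  fix z w assume "z \<in> Tcirc" "w \<in> Tcirc" "f z = f w"
  then obtain x y where xy: "z = circ x" "w = circ y" by (metis Tcirc_cases)
  then obtain m :: int where "F x = F y + of_int m"
    using \<open>f z = f w\<close> by (auto simp: f_circ circ_eq_iff)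
  then have "inv F (F x) = inv F (F (y + of_int m))" by (simp add: F_shift_int)
  then have "x = y + of_int m" by (simp only: inv_F)
  then show "z = w" by (simp add: xy)
qed

lemma inv_into_circ: "inv_into Tcirc f (circ x) = circ (inv F x)"
  using inv_into_f_f[OF inj_on_f, of "circ (inv F x)"] by (simp add: f_circ)

lemma inv_into_funpow_circ: "(inv_into Tcirc f ^^ n) (circ x) = circ (iter (- int n) x)"
  unfolding iter_neg_nat by (induction n) (simp_all add: inv_into_circ)

end

section \<open>Conjugacy with the irrational rotation\<close>

locale concave_circle_map = circle_map F f + concave_lift F a K for F f a K
begin

lemma conjugate_to_rotation:
  assumes irr: "trans_num \<notin> \<rat>"
  obtains h where "continuous_on UNIV h" "strict_mono h" "surj h"
    "\<And>k x m. h (iter k x + of_int m) = h x + of_int k * trans_num + of_int m"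
proof -
  \<comment> \<open>The supremum runs over all integers, so that shifting the index by
    \<open>j\<close> turns into adding \<open>j * trans_num\<close>; \<open>iter_bound\<close> makes
    it finite.\<close>
  define h where "h x = (SUP k::int. iter k x - of_int k * trans_num)" for x
  have "iter k x - of_int k * trans_num \<le> x + 2" for k x
    using iter_bound[of k x] by linarith
  then have bdd: "bdd_above (range (\<lambda>k. iter k x - of_int k * trans_num))" for x
    by (rule bdd_aboveI2)
  have up: "iter k x - of_int k * trans_num \<le> h x" for k x
    unfolding h_def by (rule cSUP_upper[OF _ bdd]) simp
  have h_mono: "mono h"
  proof
    fix x y :: real assume "x \<le> y"
    then have "iter k x - of_int k * trans_num \<le> h y" for k
      using up[of k y] iter_le_iff[of k x y] by linarith
    then show "h x \<le> h y" unfolding h_def[of x] by (intro cSUP_least) auto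
  qed
  have le: "h (iter j x + of_int m) \<le> h x + of_int j * trans_num + of_int m" for j x and m :: int
    unfolding h_def[of "iter j x + of_int m"]
  proof (rule cSUP_least)
    fix k
    show "iter k (iter j x + of_int m) - of_int k * trans_num \<le> h x + of_int j * trans_num + of_int m"
      using up[of "k + j" x] by (simp add: iter_shift iter_add) (simp add: algebra_simps)
  qed simp
  \<comment> \<open>The reverse inequality is \<open>le\<close> applied to the inverse iterate and
    the opposite translation.\<close>
  have h_iter: "h (iter k x + of_int m) = h x + of_int k * trans_num + of_int m" for k x and m :: int
  proof (rule antisym[OF le])
    have "h x = h (iter (- k) (iter k x + of_int m) + of_int (- m))"
      by (simp add: iter_shift)
    also have "\<dots> \<le> h (iter k x + of_int m) + of_int (- k) * trans_num + of_int (- m)" by (rule le)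
    finally show "h x + of_int k * trans_num + of_int m \<le> h (iter k x + of_int m)" by simp
  qed
  have h_strict: "strict_mono h"
  proof
    fix x y :: real assume "x < y"
    then show "h x < h y"
      using no_wandering_interval[OF irr h_mono h_iter] h_mono by (metis less_imp_le monoD order_le_less)
  qed
  \<comment> \<open>The image of the orbit of 0 with its integer translates is a rotation orbit,
    hence dense. A monotone function with dense range is continuous.\<close>
  have dense: "\<exists>w. y < h w \<and> h w < z" if yz: "y < z" for y z
  proof -
    obtain n :: nat and m :: int where "y - h 0 < real n * trans_num + of_int m"
      "real n * trans_num + of_int m < z - h 0"
      using dense_irrational_multiples[OF irr, of "y - h 0" "z - h 0"] yz by auto
    then show ?thesis
      by (intro exI[of _ "iter (int n) 0 + of_int m"]) (simp add: h_iter)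
  qed
  have h_cont: "continuous_on UNIV h"
  proof (rule continuous_onI)
    fix x e :: real assume "0 < e"
    obtain v where v: "h x < h v" "h v < h x + e" using dense[of "h x" "h x + e"] \<open>0 < e\<close> by auto
    obtain u where u: "h x - e < h u" "h u < h x" using dense[of "h x - e" "h x"] \<open>0 < e\<close> by auto
    have "u < x" "x < v" using v u h_strict by (simp_all add: strict_mono_less)
    show "\<exists>d>0. \<forall>x'\<in>UNIV. dist x' x < d \<longrightarrow> dist (h x') (h x) \<le> e"
    proof (intro exI[of _ "min (v - x) (x - u)"] conjI ballI impI)
      fix y assume "dist y x < min (v - x) (x - u)"
      then have "u \<le> y" "y \<le> v" by (auto simp: dist_real_def)
      then have "h u \<le> h y" "h y \<le> h v" using h_mono by (auto dest: monoD)
      then show "dist (h y) (h x) \<le> e" using u v by (auto simp: dist_real_def)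
    qed (use \<open>u < x\<close> \<open>x < v\<close> in auto)
  qed
  have "surj h"
  proof -
    have "y \<in> range h" for y
    proof -
      define c where "c = h 0"
      have "h (0 + of_int \<lfloor>y - c\<rfloor>) \<le> y" "y \<le> h (0 + of_int (\<lfloor>y - c\<rfloor> + 1))"
        using h_iter[of 0 0 "\<lfloor>y - c\<rfloor>"] h_iter[of 0 0 "\<lfloor>y - c\<rfloor> + 1"] unfolding c_def
        by (simp_all add: algebra_simps) linarith+
      then show ?thesis
        using IVT'[of h "0 + of_int \<lfloor>y - c\<rfloor>" y "0 + of_int (\<lfloor>y - c\<rfloor> + 1)"]
          continuous_on_subset[OF h_cont] by auto
    qed
    then show ?thesis by blast
  qed
  then show thesis using that h_cont h_strict h_iter by blast
qed

lemma circle_conjugate_to_rotation: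
  assumes irr: "trans_num \<notin> \<rat>"
  shows "\<exists>H H'. homeomorphism Tcirc Tcirc H H' \<and> (\<forall>z\<in>Tcirc. H (f z) = circ trans_num * H z)"
proof -
  obtain h where h: "continuous_on UNIV h" "strict_mono h" "surj h"
    and h_iter: "\<And>k x m. h (iter k x + of_int m) = h x + of_int k * trans_num + of_int m"
    using conjugate_to_rotation[OF irr] by blast
  \<comment> \<open>\<open>h\<close> commutes with integer translations, so the representative
    chosen by \<open>Arg\<close> does not matter.\<close>
  define H where "H z = circ (h (Arg z / (2 * pi)))" for z
  have H: "H (circ x) = circ (h x)" for x
  proof -
    obtain m :: int where "Arg (circ x) / (2 * pi) = x + of_int m"
      using circ_Arg[OF circ_in_Tcirc, of x] by (auto simp: circ_eq_iff)
    then show ?thesis using h_iter[of 0 x m] by (simp add: H_def)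
  qed
  have "inj_on H Tcirc"
  proof
    fix z w assume "z \<in> Tcirc" "w \<in> Tcirc" "H z = H w"
    then obtain x y where xy: "z = circ x" "w = circ y" by (metis Tcirc_cases)
    then obtain m :: int where "h x = h y + of_int m"
      using \<open>H z = H w\<close> by (auto simp: H circ_eq_iff)
    then have "h x = h (y + of_int m)" using h_iter[of 0 y m] by simp
    then have "x = y + of_int m" using h(2) by (simp add: strict_mono_eq)
    then show "z = w" by (simp add: xy)
  qed
  moreover have "H ` Tcirc = Tcirc"
  proof -
    have "H ` Tcirc = circ ` range h" by (simp add: Tcirc_eq image_image H)
    then show ?thesis using h(3) by (simp add: Tcirc_eq)
  qed
  moreover have "continuous_on Tcirc H"
    using continuous_on_circ_lift[OF h(1)] H by blast
  ultimately obtain H' where "homeomorphism Tcirc Tcirc H H'"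
    using homeomorphism_compact[OF compact_sphere] by blast
  moreover have "H (f z) = circ trans_num * H z" if "z \<in> Tcirc" for z
  proof -
    obtain x where "z = circ x" using \<open>z \<in> Tcirc\<close> by (rule Tcirc_cases)
    then show ?thesis using h_iter[of 1 x 0] by (simp add: f_circ H circ_add mult.commute)
  qed
  ultimately show ?thesis by blast
qed

lemma orbits_dense:
  assumes irr: "trans_num \<notin> \<rat>" and "z \<in> Tcirc"
  shows "closure (full_orbit f z) = Tcirc"
proof
  obtain h where h: "continuous_on UNIV h" "strict_mono h" "surj h"
    and h_iter: "\<And>k x m. h (iter k x + of_int m) = h x + of_int k * trans_num + of_int m"
    using conjugate_to_rotation[OF irr] by blast
  obtain x where z: "z = circ x" using \<open>z \<in> Tcirc\<close> by (rule Tcirc_cases)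
  show "closure (full_orbit f z) \<subseteq> Tcirc"
    by (rule closure_minimal) (auto simp: full_orbit_def z funpow_circ inv_into_funpow_circ)
  show "Tcirc \<subseteq> closure (full_orbit f z)"
  proof
    fix w assume "w \<in> Tcirc"
    then obtain y where w: "w = circ y" by (rule Tcirc_cases)
    show "w \<in> closure (full_orbit f z)"
      unfolding closure_approachable
    proof (intro allI impI)
      fix e :: real assume "0 < e"
      have "isCont circ y"
        using continuous_circ[of UNIV] continuous_on_eq_continuous_at[OF open_UNIV] by blast
      then obtain d where d: "0 < d" "\<And>y'. dist y' y < d \<Longrightarrow> dist (circ y') (circ y) < e"
        using \<open>0 < e\<close> unfolding continuous_at_eps_delta by blast
      \<comment> \<open>Strictness of \<open>h\<close> gives a nondegenerate target interval, which
        the forward rotation orbit already meets.\<close>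
      have "h y < h (y + d)" using h(2) d(1) by (simp add: strict_mono_less)
      then obtain n :: nat and m :: int where "h y - h x < real n * trans_num + of_int m"
        "real n * trans_num + of_int m < h (y + d) - h x"
        using dense_irrational_multiples[OF irr, of "h y - h x" "h (y + d) - h x"] by auto
      then have "h y < h (iter (int n) x + of_int m)" "h (iter (int n) x + of_int m) < h (y + d)"
        by (simp_all add: h_iter)
      then have "y < iter (int n) x + of_int m" "iter (int n) x + of_int m < y + d"
        using h(2) by (simp_all only: strict_mono_less)
      then have "dist (circ (iter (int n) x + of_int m)) (circ y) < e"
        by (intro d(2)) (simp add: dist_real_def)
      then have "dist ((f ^^ n) z) w < e" by (simp add: z w funpow_circ)
      then show "\<exists>y\<in>full_orbit f z. dist y w < e" by (auto simp: full_orbit_def)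
    qed
  qed
qed

end

section \<open>Rational rotation number\<close>

text \<open>The sequence increases below \<open>y'\<close>, so it converges to a fixed point in
  \<open>(y, y']\<close>; the only one available is \<open>y'\<close>.\<close>

lemma iterate_LIMSEQ_right:
  fixes \<phi> :: "real \<Rightarrow> real" and t :: "nat \<Rightarrow> real"
  assumes cont: "continuous_on UNIV \<phi>" and t0: "t 0 \<in> {y<..<y'}"
    and t_Suc: "\<And>n. t (Suc n) = \<phi> (t n)"
    and \<phi>: "\<And>x. x \<in> {y<..<y'} \<Longrightarrow> x < \<phi> x \<and> \<phi> x < y'"
  shows "t \<longlonglongrightarrow> y'"
proof -
  have mem: "t n \<in> {y<..<y'}" for n
    by (induction n) (use t0 t_Suc \<phi> in force)+
  have inc: "incseq t" using mem \<phi> t_Suc by (intro incseq_SucI) (metis less_imp_le)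
  obtain L where L: "t \<longlonglongrightarrow> L" "\<And>n. t n \<le> L"
    using incseq_convergent[OF inc, of y'] mem by (metis greaterThanLessThan_iff less_imp_le)
  have "(\<lambda>n. \<phi> (t n)) \<longlonglongrightarrow> \<phi> L"
    by (rule continuous_on_tendsto_compose[OF cont L(1)]) auto
  moreover have "(\<lambda>n. \<phi> (t n)) \<longlonglongrightarrow> L"
    using LIMSEQ_Suc[OF L(1)] by (simp add: t_Suc)
  ultimately have "\<phi> L = L" by (rule LIMSEQ_unique)
  moreover have "L \<le> y'" using L(1) mem by (intro LIMSEQ_le_const2[of t]) (auto intro: less_imp_le)
  moreover have "y < L" using mem[of 0] L(2)[of 0] by simp
  ultimately have "L = y'" using \<phi>[of L] by fastforce
  then show ?thesis using L(1) by simp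
qed

lemma iterate_LIMSEQ_left:
  fixes \<phi> :: "real \<Rightarrow> real" and t :: "nat \<Rightarrow> real"
  assumes cont: "continuous_on UNIV \<phi>" and t0: "t 0 \<in> {y<..<y'}"
    and t_Suc: "\<And>n. t (Suc n) = \<phi> (t n)"
    and \<phi>: "\<And>x. x \<in> {y<..<y'} \<Longrightarrow> y < \<phi> x \<and> \<phi> x < x"
  shows "t \<longlonglongrightarrow> y"
proof -
  \<comment> \<open>Reflection \<open>x \<mapsto> - x\<close> reduces to the increasing
    case.\<close>
  have "(\<lambda>n. - t n) \<longlonglongrightarrow> - y"
  proof (rule iterate_LIMSEQ_right[where \<phi> = "\<lambda>x. - \<phi> (- x)" and y = "- y'"])
    show "continuous_on UNIV (\<lambda>x. - \<phi> (- x))"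
      by (intro continuous_intros continuous_on_compose2[OF cont]) auto
    show "x < - \<phi> (- x) \<and> - \<phi> (- x) < - y" if "x \<in> {- y'<..<- y}" for x
      using \<phi>[of "- x"] that by auto
  qed (use t0 t_Suc in auto)
  then show ?thesis using tendsto_minus_cancel by blast
qed

text \<open>Concavity with denominators cleared, which suits sign arguments at zeros and covers
  \<open>x = z\<close>.\<close>

lemma concave_on_three_points:
  fixes g :: "real \<Rightarrow> real"
  assumes "concave_on I g" "x \<in> I" "z \<in> I" "x \<le> w" "w \<le> z"
  shows "(z - w) * g x + (w - x) * g z \<le> (z - x) * g w"
proof (cases "x = z")
  case False
  then have "x < z" using assms by simp
  define v where "v = (w - x) / (z - x)"
  have v: "0 \<le> v" "v \<le> 1" using assms \<open>x < z\<close> by (auto simp: v_def)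
  have w: "(1 - v) * x + v * z = w"
  proof -
    have "v * (z - x) = w - x" using \<open>x < z\<close> by (simp add: v_def)
    then show ?thesis by (simp add: algebra_simps)
  qed
  have "(1 - v) * g x + v * g z \<le> g w"
    using concave_onD[OF assms(1) v assms(2,3)] w by simp
  then have "(z - x) * ((1 - v) * g x + v * g z) \<le> (z - x) * g w"
    using \<open>x < z\<close> by (intro mult_left_mono) auto
  moreover have "(z - x) * (1 - v) = z - w" "(z - x) * v = w - x"
    using \<open>x < z\<close> by (simp_all add: v_def field_simps)
  then have "(z - x) * ((1 - v) * g x + v * g z) = (z - w) * g x + (w - x) * g z"
    by (simp only: distrib_left mult.assoc[symmetric])
  ultimately show ?thesis by simp
qed (use assms in simp)

lemma oarc_shift: "oarc (x + of_int k) (y + of_int k) = oarc x y"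
proof -
  have "{x + of_int k<..<y + of_int k} = (\<lambda>t. t + of_int k) ` {x<..<y}"
    by (auto simp: image_iff intro!: bexI[of _ "t - of_int k" for t])
  then show ?thesis by (simp add: oarc_def image_image)
qed

text \<open>\<open>P\<close> is the numerator for the lift, integer part included, whereas
  \<open>p\<close> only matters modulo \<open>q\<close> and labels the cyclic indices on the circle.
  The Bezout coefficients encode that \<open>P\<close> and \<open>q\<close> are coprime.\<close>

locale rational_circle_map = circle_map +
  fixes p q :: nat and P r s :: int
  assumes q_pos: "0 < q"
    and trans_num_eq: "real q * trans_num = of_int P"
    and P_cong: "P mod int q = int p mod int q"
    and bezout: "r * P + s * int q = 1"
begin

text \<open>By \<open>periodic_imp_per\<close> these are the lifts of all periodic points, whatever
  their period.\<close>

definition per :: "real set" where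
  "per = {x. iter (int q) x = x + of_int P}"

text \<open>On the periodic set \<open>step 1 = F\<^sup>r + s\<close> moves a point to the next point of its own orbit, because
  its translation number is \<open>r P/q + s = 1/q\<close>.\<close>

definition step :: "int \<Rightarrow> real \<Rightarrow> real" where
  "step i x = iter (r * i) x + of_int (s * i)"

lemma step_0 [simp]: "step 0 x = x"
  by (simp add: step_def)

lemma step_shift: "step i (x + of_int m) = step i x + of_int m"
  by (simp add: step_def iter_shift)

lemma step_add: "step (i + j) x = step i (step j x)"
  unfolding step_def iter_shift distrib_left iter_add by simp

lemma step_less_iff [simp]: "step i x < step i y \<longleftrightarrow> x < y"
  by (simp add: step_def)

lemma step_le_iff [simp]: "step i x \<le> step i y \<longleftrightarrow> x \<le> y"
  by (simp add: step_def)

lemma step_uminus [simp]: "step i (step (- i) x) = x" "step (- i) (step i x) = x"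
  using step_add[of i "- i" x] step_add[of "- i" i x] by auto

lemma iter_step: "iter k (step i x) = step i (iter k x)"
  unfolding step_def iter_shift by (simp add: ac_simps flip: iter_add)

lemma continuous_step: "continuous_on A (step i)"
  unfolding step_def by (intro continuous_intros continuous_iter)

lemma greater_step_iff: "step i x + of_int P < iter (int q) (step i x) \<longleftrightarrow> x + of_int P < iter (int q) x"
  by (simp add: iter_step flip: step_shift)

lemma less_step_iff: "iter (int q) (step i x) < step i x + of_int P \<longleftrightarrow> iter (int q) x < x + of_int P"
  by (simp add: iter_step flip: step_shift)

lemma per_step_iff [simp]: "step i x \<in> per \<longleftrightarrow> x \<in> per"
  using greater_step_iff[of i x] less_step_iff[of i x] by (auto simp: per_def order.eq_iff not_less[symmetric])

lemma per_iter:
  assumes "x \<in> per" shows "iter (int q * k) x = x + of_int (k * P)"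
proof (induction k rule: int_induct[where k = 0])
  case base then show ?case by simp
next
  case (step1 i)
  have "int q * (i + 1) = int q * i + int q" by (simp add: algebra_simps)
  then have "iter (int q * (i + 1)) x = iter (int q * i) (x + of_int P)"
    using assms by (simp add: iter_add per_def)
  then show ?case using step1 by (simp add: iter_shift algebra_simps)
next
  case (step2 i)
  have "int q * i = int q * (i - 1) + int q" by (simp add: algebra_simps)
  then have "iter (int q * i) x = iter (int q * (i - 1)) (x + of_int P)"
    using assms by (metis (mono_tags, lifting) iter_add mem_Collect_eq per_def)
  then show ?case using step2 by (simp add: iter_shift algebra_simps)
qed

text \<open>Since \<open>r P = 1 - s q\<close>, the exponent \<open>r (j P + m q)\<close> equals
  \<open>j + q (r m - s j)\<close>, and multiples of \<open>q\<close> act on \<open>per\<close> as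
  translations. Thus the lifted orbit is indexed by the single integer
  \<open>j P + m q\<close>.\<close>

lemma per_orbit:
  assumes "x \<in> per" shows "iter j x + of_int m = step (j * P + m * int q) x"
proof -
  have "r * (j * P + m * int q) = j * (r * P) + int q * (r * m)" by (simp add: algebra_simps)
  also have "\<dots> = j + int q * (r * m - s * j)"
  proof -
    have "r * P = 1 - s * int q" using bezout by simp
    then show ?thesis by (simp only:) (simp add: algebra_simps)
  qed
  finally have "iter (r * (j * P + m * int q)) x = iter j x + of_int ((r * m - s * j) * P)"
    by (simp only: iter_add per_iter[OF assms] iter_shift)
  moreover have "(r * m - s * j) * P + s * (j * P + m * int q) = m * (r * P + s * int q)"
    by (simp add: algebra_simps)
  ultimately show ?thesis unfolding step_def bezout
    by (metis add.assoc mult.right_neutral of_int_add)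
qed

lemma step_q:
  assumes "x \<in> per" shows "step (k * int q) x = x + of_int k"
  using per_orbit[OF assms, of 0 k] by simp

lemma step_mult_q:
  assumes "x \<in> per" shows "step (i + int q * k) x = step i x + of_int k"
  using step_q[OF assms, of k] by (simp add: step_add step_shift mult.commute)

text \<open>If one step did not move right, neither would \<open>q\<close> steps; but these
  translate by 1.\<close>

lemma step_gt:
  assumes "x \<in> per" "0 < i" shows "x < step i x"
proof -
  have "x < step 1 x"
  proof (rule ccontr)
    assume "\<not> x < step 1 x"
    then have le: "step 1 x \<le> x" by simp
    have "step (int n) x \<le> x" for n
    proof (induction n)
      case (Suc n)
      have "step (int (Suc n)) x = step 1 (step (int n) x)" by (simp flip: step_add)
      also have "\<dots> \<le> step 1 x" using Suc by simp
      finally show ?case using le by simp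
    qed simp
    from this[of q] show False using step_q[OF assms(1), of 1] by simp
  qed
  moreover have "x < step (int (Suc n)) x" for n
  proof (induction n)
    case 0 then show ?case using \<open>x < step 1 x\<close> by simp
  next
    case (Suc n)
    have "step (int (Suc (Suc n))) x = step 1 (step (int (Suc n)) x)" by (simp flip: step_add)
    moreover have "step 1 x < step 1 (step (int (Suc n)) x)" using Suc by simp
    ultimately show ?case using \<open>x < step 1 x\<close> by (metis less_trans)
  qed
  ultimately show ?thesis using assms(2) by (metis gr0_conv_Suc pos_int_cases)
qed

lemma step_index_less_iff:
  assumes "x \<in> per" shows "step i x < step j x \<longleftrightarrow> i < j"
proof -
  have *: "step i x < step j x" if "i < j" for i j
    using step_gt[OF assms, of "j - i"] that step_add[of i "j - i" x] step_less_iff[of i x "step (j - i) x"] by simp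
  show ?thesis using *[of i j] *[of j i] by (metis less_asym less_irrefl linorder_cases)
qed

lemma step_index_le_iff:
  assumes "x \<in> per" shows "step i x \<le> step j x \<longleftrightarrow> i \<le> j"
  using step_index_less_iff[OF assms, of j i] by (simp add: linorder_not_less[symmetric])

text \<open>Start at the integer translate of \<open>y\<close> just left of \<open>x\<close> and
  take the last step that does not pass \<open>x\<close>.\<close>

lemma step_cover:
  assumes "y \<in> per"
  obtains i where "step i y \<le> x" "x < step (i + 1) y"
proof -
  define i0 where "i0 = \<lfloor>x - y\<rfloor> * int q"
  have i0: "step i0 y \<le> x" unfolding i0_def step_q[OF assms] by linarith
  have "x < step (i0 + int q) y"
    using step_q[OF assms, of "\<lfloor>x - y\<rfloor> + 1"] unfolding i0_def by (simp add: algebra_simps) linarith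
  then obtain n where n: "x < step (i0 + int n) y" "\<And>k. k < n \<Longrightarrow> \<not> x < step (i0 + int k) y"
    using exists_least_iff[of "\<lambda>n. x < step (i0 + int n) y"] by blast
  have "n \<noteq> 0" using n(1) i0 by (metis add_0_right linorder_not_less of_nat_0)
  then obtain k where "n = Suc k" using not0_implies_Suc by blast
  then show ?thesis
    using n(1) n(2)[of k] that[of "i0 + int k"] by (simp add: add.assoc add.commute[of 1])
qed

lemma index_mod:
  obtains k where "int i + int n * P = int ((i + p * n) mod q) + int q * k"
proof -
  have "(int i + int n * P) mod int q = (int i + int n * int p) mod int q"
    by (metis P_cong mod_add_cong mod_mult_cong)
  also have "\<dots> = int ((i + p * n) mod q)" by (simp add: zmod_int mult.commute)
  finally show ?thesis
    using that[of "(int i + int n * P) div int q"] mult_div_mod_eq[of "int q" "int i + int n * P"] by simp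
qed

text \<open>The source of the rule \<open>i \<mapsto> i + p n\<close> on cyclic indices; one integer
  \<open>k\<close> serves all points of \<open>per\<close>.\<close>

lemma iter_step_index:
  obtains k where "\<And>x. x \<in> per \<Longrightarrow> iter (int n) (step (int i) x) = step (int ((i + p * n) mod q)) x + of_int k"
proof -
  obtain k where k: "int i + int n * P = int ((i + p * n) mod q) + int q * k" by (rule index_mod)
  show thesis
  proof (rule that)
    fix x assume x: "x \<in> per"
    have "iter (int n) (step (int i) x) = step (int i + int n * P) x"
      using per_orbit[OF x, of "int n" 0] by (simp add: iter_step step_add)
    then show "iter (int n) (step (int i) x) = step (int ((i + p * n) mod q)) x + of_int k"
      unfolding k step_mult_q[OF x] .
  qed
qed

lemma nxt_step:
  assumes "x \<in> per" "i < q"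
  shows "nxt q (\<lambda>i. step (int i) x) i = step (int i + 1) x"
proof (cases "i + 1 < q")
  case False
  then have "int i + 1 = 1 * int q" using assms(2) by simp
  then show ?thesis using False step_q[OF assms(1), of 1] by (simp add: nxt_def)
qed (simp add: nxt_def add.commute)

text \<open>Comparing translation numbers gives \<open>n P = q k\<close>. If
  \<open>F\<^sup>q x\<close> were strictly on one side of \<open>x + P\<close>, monotonicity would
  keep \<open>F\<^sup>q\<^sup>n x\<close> strictly on that side of \<open>x + n P\<close>, although
  both agree.\<close>

lemma periodic_imp_per:
  assumes "0 < n" "iter (int n) x = x + of_int k"
  shows "x \<in> per"
proof -
  have rep: "iter (int j * int n) x = x + of_int (int j * k)" for j
  proof (induction j)
    case (Suc j)
    have "iter (int (Suc j) * int n) x = iter (int j * int n) (iter (int n) x)"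
      by (simp add: distrib_right iter_add[symmetric] add.commute)
    then show ?case using Suc assms(2) by (simp add: iter_shift algebra_simps)
  qed simp
  have "of_int (int n) * trans_num = of_int k"
    by (rule trans_num_unique[of "int n" x _ 0]) (use rep in simp)
  then have "real q * real n * trans_num = real q * of_int k" by simp
  then have "real n * of_int P = real q * of_int k"
    using trans_num_eq by (metis mult.assoc mult.commute)
  then have nP: "int n * P = int q * k" by (metis of_int_eq_iff of_int_mult of_int_of_nat_eq)
  have split: "iter (int q * int (Suc j)) x = iter (int q) (iter (int q * int j) x)" for j
    by (simp add: distrib_left iter_add)
  have gt: "x + of_int (int (Suc j) * P) < iter (int q * int (Suc j)) x" if "x + of_int P < iter (int q) x" for j
  proof (induction j)
    case 0 then show ?case using that by simp
  next
    case (Suc j)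
    have "iter (int q) (x + of_int (int (Suc j) * P)) < iter (int q * int (Suc (Suc j))) x"
      unfolding split[of "Suc j"] iter_less_iff by (rule Suc)
    then show ?case unfolding iter_shift using that by (simp add: algebra_simps)
  qed
  have lt: "iter (int q * int (Suc j)) x < x + of_int (int (Suc j) * P)" if "iter (int q) x < x + of_int P" for j
  proof (induction j)
    case 0 then show ?case using that by simp
  next
    case (Suc j)
    have "iter (int q * int (Suc (Suc j))) x < iter (int q) (x + of_int (int (Suc j) * P))"
      unfolding split[of "Suc j"] iter_less_iff by (rule Suc)
    then show ?case unfolding iter_shift using that by (simp add: algebra_simps)
  qed
  have "iter (int q * int n) x = x + of_int (int n * P)" using rep[of q] nP by simp
  then show ?thesis
    using gt[of "n - 1"] lt[of "n - 1"] assms(1) unfolding per_def by fastforce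
qed

text \<open>Without zeros \<open>F\<^sup>q - id - P\<close> has constant sign and, by periodicity
  and compactness, modulus at least some \<open>e > 0\<close>. The orbit of 0 then drifts linearly
  from its mean motion, contrary to \<open>iter_bound\<close>.\<close>

lemma per_nonempty: "per \<noteq> {}"
proof
  assume empty: "per = {}"
  define g where "g x = iter (int q) x - x - of_int P" for x
  have cont: "continuous_on A g" for A unfolding g_def by (intro continuous_intros continuous_iter)
  have nz: "g x \<noteq> 0" for x
  proof -
    have "x \<notin> per" using empty by blast
    then show ?thesis by (simp add: per_def g_def algebra_simps)
  qed
  have same: "0 < g x \<longleftrightarrow> 0 < g y" if "x \<le> y" for x y
    using IVT'[of g x 0 y, OF _ _ that cont] IVT2'[of g y 0 x, OF _ _ that cont] nz
    by (metis linorder_le_cases order_le_less)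
  have gper: "g (x + of_int m) = g x" for x m by (simp add: g_def iter_shift)
  obtain e where e: "0 < e" "\<And>x. e \<le> \<bar>g x\<bar>"
  proof -
    obtain x0 where x0: "\<And>x. x \<in> {0..1} \<Longrightarrow> \<bar>g x0\<bar> \<le> \<bar>g x\<bar>"
      using continuous_attains_inf[of "{0..1}" "\<lambda>x. \<bar>g x\<bar>"] continuous_on_rabs[OF cont] by force
    have "\<bar>g x0\<bar> \<le> \<bar>g x\<bar>" for x
    proof -
      have "frac x \<in> {0..1}" using frac_lt_1[of x] by (simp add: less_imp_le)
      then show ?thesis using x0[of "frac x"] gper[of x "- \<lfloor>x\<rfloor>"] by (simp add: frac_def)
    qed
    then show ?thesis using that[of "\<bar>g x0\<bar>"] nz by simp
  qed
  have split: "iter (int q * int (Suc j)) 0 = iter (int q) (iter (int q * int j) 0)" for j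
    by (simp add: distrib_left iter_add)
  have bound: "\<bar>iter (int q * int n) 0 - real n * of_int P\<bar> \<le> 2" for n
  proof -
    have "of_int (int q * int n) * trans_num = real n * (real q * trans_num)" by simp
    then have "of_int (int q * int n) * trans_num = real n * of_int P" by (simp only: trans_num_eq)
    then show ?thesis using iter_bound[of "int q * int n" 0] by (simp only: diff_0_right)
  qed
  obtain n :: nat where n: "2 < real n * e" using reals_Archimedean3[OF e(1)] by blast
  show False
  proof (cases "0 < g 0")
    case True
    have "e \<le> g x" for x
      using e(2)[of x] same[of 0 x] same[of x 0] True nz[of x] by (cases "0 \<le> x") auto
    then have "iter (int q * int n) 0 \<ge> real n * (of_int P + e)" for n
    proof (induction n)
      case (Suc n)
      then have "e \<le> g (iter (int q * int n) 0)" by blast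
      then show ?case using Suc unfolding split by (simp add: g_def algebra_simps)
    qed simp
    from this[of n] show False using bound[of n] n by (simp add: algebra_simps)
  next
    case False
    have "g x \<le> - e" for x
      using e(2)[of x] same[of 0 x] same[of x 0] False nz[of x] by (cases "0 \<le> x") auto
    then have "iter (int q * int n) 0 \<le> real n * (of_int P - e)" for n
    proof (induction n)
      case (Suc n)
      then have "g (iter (int q * int n) 0) \<le> - e" by blast
      then show ?case using Suc unfolding split by (simp add: g_def algebra_simps)
    qed simp
    from this[of n] show False using bound[of n] n by (simp add: algebra_simps)
  qed
qed

text \<open>\<open>A\<close> and \<open>A'\<close> lift the pieces of index 0; \<open>step\<close>
  produces the others.\<close>

lemma periodic_structureI:
  assumes "A \<subseteq> per" "A' \<subseteq> per"
    and cover: "\<And>x. x \<in> per \<Longrightarrow> \<exists>i. \<exists>w \<in> A \<union> A'. x = step i w"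
    and Pp: "\<And>i. i < q \<Longrightarrow> Pp i = (\<lambda>x. circ (step (int i) x)) ` A"
    and Pm: "\<And>i. i < q \<Longrightarrow> Pm i = (\<lambda>x. circ (step (int i) x)) ` A'"
  shows "periodic_structure f p q Pp Pm"
proof -
  have img: "(f ^^ n) ` Q i = Q ((i + p * n) mod q)"
    if "i < q" "B \<subseteq> per" and Q: "\<And>i. i < q \<Longrightarrow> Q i = (\<lambda>x. circ (step (int i) x)) ` B" for n i B Q
  proof -
    obtain k where "\<And>x. x \<in> per \<Longrightarrow> iter (int n) (step (int i) x) = step (int ((i + p * n) mod q)) x + of_int k"
      by (rule iter_step_index[where n = n and i = i]) blast
    then have "circ (iter (int n) (step (int i) x)) = circ (step (int ((i + p * n) mod q)) x)" if "x \<in> B" for x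
      using that \<open>B \<subseteq> per\<close> by auto
    then show ?thesis
      using Q[OF \<open>i < q\<close>] Q[of "(i + p * n) mod q"] q_pos by (simp add: image_image funpow_circ)
  qed
  have fix_q: "(f ^^ q) z = z" if iz: "i < q" "z \<in> Pp i \<union> Pm i" for i z
  proof -
    obtain x where x: "x \<in> per" "z = circ (step (int i) x)"
      using iz(2) assms(1,2) unfolding Pp[OF iz(1)] Pm[OF iz(1)] by blast
    then have "iter (int q) (step (int i) x) = step (int i) x + of_int P"
      using per_step_iff[of "int i" x] unfolding per_def by blast
    then show ?thesis by (simp add: x(2) funpow_circ)
  qed
  have "(f ^^ n) z \<noteq> z" if z: "z \<in> Tcirc - ((\<Union>i<q. Pp i) \<union> (\<Union>i<q. Pm i))" and "0 < n" for z n
  proof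
    assume fix_n: "(f ^^ n) z = z"
    obtain x where x: "z = circ x" using z Tcirc_cases by blast
    then obtain k where "iter (int n) x = x + of_int k"
      using fix_n by (auto simp: funpow_circ circ_eq_iff)
    then have "x \<in> per" using periodic_imp_per \<open>0 < n\<close> by blast
    then obtain i w where w: "w \<in> A \<union> A'" "x = step i w" using cover by blast
    then have "w \<in> per" using assms(1,2) by blast
    \<comment> \<open>Changing the step index by a multiple of \<open>q\<close> is an integer
      translation, invisible on the circle.\<close>
    define j where "j = nat (i mod int q)"
    have j: "j < q" "int j = i mod int q" using q_pos by (simp_all add: j_def nat_less_iff)
    have "i = int j + int q * (i div int q)" using j(2) by simp
    then have "z = circ (step (int j) w)"
      using step_mult_q[OF \<open>w \<in> per\<close>, of "int j" "i div int q"] x w(2) by simp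
    then have "z \<in> Pp j \<union> Pm j" using w(1) Pp[OF j(1)] Pm[OF j(1)] by blast
    then show False using z j(1) by blast
  qed
  moreover have "(f ^^ n) ` Pp i = Pp ((i + p * n) mod q)" "(f ^^ n) ` Pm i = Pm ((i + p * n) mod q)"
    if "i < q" for i n
    using img[OF that assms(1), of Pp n] img[OF that assms(2), of Pm n] Pp Pm by metis+
  ultimately show ?thesis
    unfolding periodic_structure_def using fix_q by (intro conjI allI impI ballI) auto
qed

section \<open>Dynamics in the gaps between periodic pieces\<close>

lemma gap_dynamics_core:
  assumes y: "y \<in> per" "y' \<in> per"
    and ends: "\<And>i. i < q \<Longrightarrow> lo i = step (int i) y \<and> hi i = step (int i) y' \<and>
      att i = step (int i) w \<and> rep i = step (int i) w'"
    and fwd: "\<And>x. x \<in> {y<..<y'} \<Longrightarrow> (\<lambda>n. iter (int q * int n) x - of_int (int n * P)) \<longlonglongrightarrow> w"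
    and bwd: "\<And>x. x \<in> {y<..<y'} \<Longrightarrow> (\<lambda>n. iter (- (int q * int n)) x + of_int (int n * P)) \<longlonglongrightarrow> w'"
  shows "gap_dynamics f p q lo hi att rep"
  unfolding gap_dynamics_def
proof (intro allI impI ballI)
  fix i z assume "i < q" "z \<in> oarc (lo i) (hi i)"
  then obtain x' where x': "z = circ x'" "step (int i) y < x'" "x' < step (int i) y'"
    using ends[OF \<open>i < q\<close>] unfolding oarc_def by auto
  \<comment> \<open>Pull back to the gap of index 0; \<open>step\<close> commutes with
    \<open>F\<close>, so the limits are transported by continuity.\<close>
  define x where "x = step (- int i) x'"
  have x'_eq: "x' = step (int i) x" by (simp add: x_def)
  have x: "x \<in> {y<..<y'}" using x'(2,3) unfolding x'_eq by simp
  have "(f ^^ n) z \<in> oarc (lo ((i + p * n) mod q)) (hi ((i + p * n) mod q))" for n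
  proof -
    obtain k where k: "\<And>x. x \<in> per \<Longrightarrow> iter (int n) (step (int i) x) = step (int ((i + p * n) mod q)) x + of_int k"
      by (rule iter_step_index[where n = n and i = i]) blast
    have "iter (int n) (step (int i) y) < iter (int n) x'" "iter (int n) x' < iter (int n) (step (int i) y')"
      using x'(2,3) by simp_all
    then have "circ (iter (int n) x') \<in> oarc (step (int ((i + p * n) mod q)) y + of_int k)
        (step (int ((i + p * n) mod q)) y' + of_int k)"
      unfolding k[OF y(1)] k[OF y(2)] oarc_def by auto
    then show ?thesis
      using ends[of "(i + p * n) mod q"] q_pos by (simp add: oarc_shift x'(1) funpow_circ)
  qed
  moreover have "(\<lambda>n. (f ^^ (n * q)) z) \<longlonglongrightarrow> circ (att i)"
  proof -
    have "(\<lambda>n. circ (step (int i) (iter (int q * int n) x - of_int (int n * P)))) \<longlonglongrightarrow> circ (step (int i) w)"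
      by (intro tendsto_circ continuous_on_tendsto_compose[OF continuous_step[of UNIV]] fwd x) auto
    moreover have "circ (step (int i) (iter (int q * int n) x - of_int (int n * P))) = (f ^^ (n * q)) z" for n
    proof -
      have "iter (int q * int n) x - of_int (int n * P) = iter (int q * int n) x + of_int (- (int n * P))"
        by simp
      then show ?thesis
        unfolding x'(1) x'_eq funpow_circ iter_step by (simp only: step_shift circ_shift) (simp add: mult.commute)
    qed
    ultimately show ?thesis using ends[OF \<open>i < q\<close>] by simp
  qed
  moreover have "(\<lambda>n. (inv_into Tcirc f ^^ (n * q)) z) \<longlonglongrightarrow> circ (rep i)"
  proof -
    have "(\<lambda>n. circ (step (int i) (iter (- (int q * int n)) x + of_int (int n * P)))) \<longlonglongrightarrow> circ (step (int i) w')"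
      by (intro tendsto_circ continuous_on_tendsto_compose[OF continuous_step[of UNIV]] bwd x) auto
    moreover have "circ (step (int i) (iter (- (int q * int n)) x + of_int (int n * P))) = (inv_into Tcirc f ^^ (n * q)) z" for n
      unfolding step_shift circ_shift x'(1) x'_eq inv_into_funpow_circ iter_step by (simp add: mult.commute)
    ultimately show ?thesis using ends[OF \<open>i < q\<close>] by simp
  qed
  ultimately show "(\<forall>n. (f ^^ n) z \<in> oarc (lo ((i + p * n) mod q)) (hi ((i + p * n) mod q))) \<and>
      (\<lambda>n. (f ^^ (n * q)) z) \<longlonglongrightarrow> circ (att i) \<and>
      (\<lambda>n. (inv_into Tcirc f ^^ (n * q)) z) \<longlonglongrightarrow> circ (rep i)"
    by blast
qed

lemma iter_q_Suc:
  "iter (int q * int (Suc n)) x - of_int (int (Suc n) * P)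
    = iter (int q) (iter (int q * int n) x - of_int (int n * P)) - of_int P"
proof -
  have "iter (int q * int (Suc n)) x = iter (int q) (iter (int q * int n) x)"
    by (simp add: distrib_left iter_add)
  then show ?thesis
    using iter_shift[of "int q" "iter (int q * int n) x" "- (int n * P)"] by (simp add: algebra_simps)
qed

lemma iter_neg_q_Suc:
  "iter (- (int q * int (Suc n))) x + of_int (int (Suc n) * P)
    = iter (- int q) (iter (- (int q * int n)) x + of_int (int n * P)) + of_int P"
proof -
  have "- (int q * int (Suc n)) = - int q + - (int q * int n)" by (simp add: algebra_simps)
  then have "iter (- (int q * int (Suc n))) x = iter (- int q) (iter (- (int q * int n)) x)"
    by (simp only: iter_add)
  then show ?thesis
    unfolding iter_shift by (simp add: algebra_simps)
qed

lemma per_iter_neg: "x \<in> per \<Longrightarrow> iter (- int q) x = x - of_int P"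
  using per_iter[of x "- 1"] by simp

text \<open>\<open>F\<^sup>q - P\<close> pushes the gap to the right, so forward orbits converge to
  its right end and backward orbits to its left end.\<close>

lemma gap_dynamics_up:
  assumes y: "y \<in> per" "y' \<in> per"
    and up: "\<And>x. x \<in> {y<..<y'} \<Longrightarrow> x + of_int P < iter (int q) x"
    and ends: "\<And>i. i < q \<Longrightarrow> lo i = step (int i) y \<and> hi i = step (int i) y' \<and>
      att i = step (int i) y' \<and> rep i = step (int i) y"
  shows "gap_dynamics f p q lo hi att rep"
proof (rule gap_dynamics_core[OF y ends])
  fix x assume x: "x \<in> {y<..<y'}"
  show "(\<lambda>n. iter (int q * int n) x - of_int (int n * P)) \<longlonglongrightarrow> y'"
  proof (rule iterate_LIMSEQ_right[where \<phi> = "\<lambda>x. iter (int q) x - of_int P"])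
    show "iter (int q * int (Suc n)) x - of_int (int (Suc n) * P)
      = iter (int q) (iter (int q * int n) x - of_int (int n * P)) - of_int P" for n
      by (rule iter_q_Suc)
    fix w assume w: "w \<in> {y<..<y'}"
    then have "iter (int q) w < iter (int q) y'" by simp
    then show "w < iter (int q) w - of_int P \<and> iter (int q) w - of_int P < y'"
      using up[OF w] y(2) unfolding per_def mem_Collect_eq by linarith
  qed (use x in \<open>auto intro!: continuous_intros continuous_iter\<close>)
  show "(\<lambda>n. iter (- (int q * int n)) x + of_int (int n * P)) \<longlonglongrightarrow> y"
  proof (rule iterate_LIMSEQ_left[where \<phi> = "\<lambda>x. iter (- int q) x + of_int P"])
    show "iter (- (int q * int (Suc n))) x + of_int (int (Suc n) * P)
      = iter (- int q) (iter (- (int q * int n)) x + of_int (int n * P)) + of_int P" for n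
      by (rule iter_neg_q_Suc)
    fix w assume w: "w \<in> {y<..<y'}"
    then have "iter (- int q) y < iter (- int q) w" by simp
    moreover have "iter (- int q) (w + of_int P) < iter (- int q) (iter (int q) w)"
      using up[OF w] by (simp only: iter_less_iff)
    ultimately show "y < iter (- int q) w + of_int P \<and> iter (- int q) w + of_int P < w"
      using per_iter_neg[OF y(1)] by (simp add: iter_shift)
  qed (use x in \<open>auto intro!: continuous_intros continuous_iter\<close>)
qed

lemma gap_dynamics_down:
  assumes y: "y \<in> per" "y' \<in> per"
    and down: "\<And>x. x \<in> {y<..<y'} \<Longrightarrow> iter (int q) x < x + of_int P"
    and ends: "\<And>i. i < q \<Longrightarrow> lo i = step (int i) y \<and> hi i = step (int i) y' \<and>
      att i = step (int i) y \<and> rep i = step (int i) y'"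
  shows "gap_dynamics f p q lo hi att rep"
proof (rule gap_dynamics_core[OF y ends])
  fix x assume x: "x \<in> {y<..<y'}"
  show "(\<lambda>n. iter (int q * int n) x - of_int (int n * P)) \<longlonglongrightarrow> y"
  proof (rule iterate_LIMSEQ_left[where \<phi> = "\<lambda>x. iter (int q) x - of_int P"])
    show "iter (int q * int (Suc n)) x - of_int (int (Suc n) * P)
      = iter (int q) (iter (int q * int n) x - of_int (int n * P)) - of_int P" for n
      by (rule iter_q_Suc)
    fix w assume w: "w \<in> {y<..<y'}"
    then have "iter (int q) y < iter (int q) w" by simp
    then show "y < iter (int q) w - of_int P \<and> iter (int q) w - of_int P < w"
      using down[OF w] y(1) unfolding per_def mem_Collect_eq by linarith
  qed (use x in \<open>auto intro!: continuous_intros continuous_iter\<close>)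
  show "(\<lambda>n. iter (- (int q * int n)) x + of_int (int n * P)) \<longlonglongrightarrow> y'"
  proof (rule iterate_LIMSEQ_right[where \<phi> = "\<lambda>x. iter (- int q) x + of_int P"])
    show "iter (- (int q * int (Suc n))) x + of_int (int (Suc n) * P)
      = iter (- int q) (iter (- (int q * int n)) x + of_int (int n * P)) + of_int P" for n
      by (rule iter_neg_q_Suc)
    fix w assume w: "w \<in> {y<..<y'}"
    then have "iter (- int q) w < iter (- int q) y'" by simp
    moreover have "iter (- int q) (iter (int q) w) < iter (- int q) (w + of_int P)"
      using down[OF w] by (simp only: iter_less_iff)
    ultimately show "w < iter (- int q) w + of_int P \<and> iter (- int q) w + of_int P < y'"
      using per_iter_neg[OF y(2)] by (simp add: iter_shift)
  qed (use x in \<open>auto intro!: continuous_intros continuous_iter\<close>)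
qed

lemma per_reduce:
  assumes "y \<in> per" "x \<in> per"
  obtains i where "step (- i) x \<in> per" "y \<le> step (- i) x" "step (- i) x < step 1 y"
proof -
  obtain i where i: "step i y \<le> x" "x < step (i + 1) y" by (rule step_cover[OF assms(1)])
  have "step (- i) (step i y) \<le> step (- i) x" "step (- i) x < step (- i) (step (i + 1) y)"
    using i by (simp_all only: step_le_iff step_less_iff)
  then show ?thesis using that[of i] assms(2) by (simp flip: step_add)
qed

text \<open>On the fundamental interval from \<open>xm\<close> to \<open>step 1 xm\<close> the sign
  pattern is plus, then minus, with \<open>xp\<close> in between. Hence the only zeros are the two
  given points up to steps.\<close>

lemma case_aI:
  assumes per: "xm \<in> per" "xp \<in> per" and ord: "xm \<le> xp" "xp \<le> step 1 xm"
    and up: "\<And>x. x \<in> {xm<..<xp} \<Longrightarrow> x + of_int P < iter (int q) x"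
    and down: "\<And>x. x \<in> {xp<..<step 1 xm} \<Longrightarrow> iter (int q) x < x + of_int P"
  shows "case_a f p q"
  unfolding case_a_def
proof (intro exI conjI allI impI)
  let ?xm = "\<lambda>i. step (int i) xm" and ?xp = "\<lambda>i. step (int i) xp"
  have nxt: "nxt q ?xm i = step (int i) (step 1 xm)" if "i < q" for i
    using nxt_step[OF per(1) that] by (simp add: step_add)
  show "?xm i \<le> ?xp i" for i using ord(1) by simp
  show "?xp i \<le> nxt q ?xm i" if "i < q" for i using ord(2) nxt[OF that] by simp
  show "periodic_structure f p q (\<lambda>i. {circ (?xp i)}) (\<lambda>i. {circ (?xm i)})"
  proof (rule periodic_structureI[of "{xp}" "{xm}"])
    fix x assume "x \<in> per"
    then obtain i where i: "step (- i) x \<in> per" "xm \<le> step (- i) x" "step (- i) x < step 1 xm"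
      using per_reduce[OF per(1)] by blast
    have "step (- i) x = xm \<or> step (- i) x = xp"
      using i up[of "step (- i) x"] down[of "step (- i) x"] unfolding per_def by fastforce
    then show "\<exists>i. \<exists>w\<in>{xp} \<union> {xm}. x = step i w" by (metis UnI1 UnI2 singletonI step_uminus(1))
  qed (use per in auto)
  show "gap_dynamics f p q ?xm ?xp ?xp ?xm"
    by (rule gap_dynamics_up[OF per up]) auto
  show "gap_dynamics f p q ?xp (nxt q ?xm) ?xp (nxt q ?xm)"
    by (rule gap_dynamics_down[OF per(2) _ down]) (use per nxt in auto)
qed

text \<open>The equality \<open>xR = step 1 xL\<close> gives the subcase in which the periodic
  intervals cover the circle.\<close>

lemma case_bI:
  assumes "xL < xR" "xR \<le> step 1 xL" and sub: "{xL..xR} \<subseteq> per"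
    and down: "\<And>x. x \<in> {xR<..<step 1 xL} \<Longrightarrow> iter (int q) x < x + of_int P"
  shows "case_b f p q"
  unfolding case_b_def
proof (intro exI conjI allI impI)
  let ?xL = "\<lambda>i. step (int i) xL" and ?xR = "\<lambda>i. step (int i) xR"
  have per: "xL \<in> per" "xR \<in> per" using assms(1) sub by auto
  have nxt: "nxt q ?xL i = step (int i) (step 1 xL)" if "i < q" for i
    using nxt_step[OF per(1) that] by (simp add: step_add)
  show "?xL i < ?xR i" for i using assms(1) by simp
  show "?xR i \<le> nxt q ?xL i" if "i < q" for i using assms(2) nxt[OF that] by simp
  have arc: "carc (?xL i) (?xR i) = (\<lambda>x. circ (step (int i) x)) ` {xL..xR}" for i
  proof -
    have "x \<in> step (int i) ` {xL..xR}" if "?xL i \<le> x" "x \<le> ?xR i" for x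
    proof
      show "x = step (int i) (step (- int i) x)" by simp
      have "step (- int i) (?xL i) \<le> step (- int i) x" "step (- int i) x \<le> step (- int i) (?xR i)"
        using that by (simp_all only: step_le_iff)
      then show "step (- int i) x \<in> {xL..xR}" by simp
    qed
    then have "{?xL i..?xR i} = step (int i) ` {xL..xR}" by auto
    then show ?thesis by (simp add: carc_def image_image)
  qed
  have cover: "\<exists>i. \<exists>w\<in>{xL..xR}. x = step i w" if x: "x \<in> per" for x
  proof -
    obtain i where i: "step (- i) x \<in> per" "xL \<le> step (- i) x" "step (- i) x < step 1 xL"
      using per_reduce[OF per(1) x] by blast
    have "step (- i) x \<in> {xL..xR}"
      using i down[of "step (- i) x"] unfolding per_def by fastforce
    then show ?thesis by (metis step_uminus(1))
  qed
  show "periodic_structure f p q (\<lambda>i. carc (?xL i) (?xR i)) (\<lambda>i. carc (?xL i) (?xR i))"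
    by (rule periodic_structureI[of "{xL..xR}" "{xL..xR}"]) (use sub arc cover in auto)
  show "(\<forall>i<q. ?xR i < nxt q ?xL i) \<or> (\<forall>i<q. ?xR i = nxt q ?xL i)"
    using nxt assms(2) by (cases "xR = step 1 xL") auto
  show "gap_dynamics f p q ?xR (nxt q ?xL) ?xR (nxt q ?xL)"
    by (rule gap_dynamics_down[OF per(2) _ down]) (use per nxt in auto)
  show "\<forall>z\<in>Tcirc. \<exists>n>0. (f ^^ n) z = z" if eq: "\<forall>i<q. ?xR i = nxt q ?xL i"
  proof
    fix z assume "z \<in> Tcirc"
    then obtain x where x: "z = circ x" by (rule Tcirc_cases)
    have "xR = step 1 xL" using eq nxt[of 0] q_pos by auto
    obtain i where i: "step i xL \<le> x" "x < step (i + 1) xL" by (rule step_cover[OF per(1)])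
    have "step (- i) (step i xL) \<le> step (- i) x" "step (- i) x < step (- i) (step (i + 1) xL)"
      using i by (simp_all only: step_le_iff step_less_iff)
    then have "step (- i) x \<in> {xL..xR}" using \<open>xR = step 1 xL\<close> by (simp flip: step_add)
    then have "x \<in> per" using sub per_step_iff by blast
    then have "(f ^^ q) z = z" by (simp add: x funpow_circ per_def)
    then show "\<exists>n>0. (f ^^ n) z = z" using q_pos by blast
  qed
qed

end

section \<open>Periodic points of concave lifts\<close>

lemma strictly_concave_onD:
  assumes "strictly_concave_on S g" "x \<in> S" "y \<in> S" "x \<noteq> y" "0 < t" "t < 1"
  shows "t * g x + (1 - t) * g y < g (t * x + (1 - t) * y)"
  using assms unfolding strictly_concave_on_def by blast

context concave_lift
begin

lemma unit_interval_shift: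
  assumes "\<And>m::int. \<not> (c < a + of_int m \<and> a + of_int m < d)"
  obtains m :: int where "{c - of_int m..d - of_int m} \<subseteq> {a..a + 1}"
proof -
  define m where "m = \<lfloor>c - a\<rfloor>"
  have "a \<le> c - of_int m" "c < a + of_int (m + 1)" unfolding m_def by linarith+
  moreover have "d \<le> a + of_int (m + 1)" using assms[of "m + 1"] calculation by auto
  ultimately have "{c - of_int m..d - of_int m} \<subseteq> {a..a + 1}" by auto
  then show ?thesis by (rule that)
qed

text \<open>The break points of \<open>F\<^sup>n\<close> are the
  \<open>F\<^sup>-\<^sup>j a + m\<close> with \<open>j < n\<close>. Avoiding them, each image of
  \<open>[c, d]\<close> stays in one period of \<open>F\<close>, and composing with an increasing
  concave function preserves concavity.\<close>

lemma concave_on_iter: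
  assumes "\<And>j m. j < n \<Longrightarrow> \<not> (c < iter (- int j) a + of_int m \<and> iter (- int j) a + of_int m < d)"
  shows "concave_on {c..d} (iter (int n))"
  using assms
proof (induction n)
  case 0
  then show ?case by (simp add: concave_on_iff)
next
  case (Suc n)
  have IH: "concave_on {c..d} (iter (int n))" using Suc by simp
  have nobr: "\<not> (iter (int n) c < a + of_int m \<and> a + of_int m < iter (int n) d)" for m :: int
  proof
    assume "iter (int n) c < a + of_int m \<and> a + of_int m < iter (int n) d"
    then have "iter (- int n) (iter (int n) c) < iter (- int n) (a + of_int m)"
      "iter (- int n) (a + of_int m) < iter (- int n) (iter (int n) d)" by (simp_all only: iter_less_iff)
    then show False using Suc.prems[of n m] by (simp add: iter_shift)
  qed
  obtain k :: int where k: "{iter (int n) c - of_int k..iter (int n) d - of_int k} \<subseteq> {a..a + 1}"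
    using unit_interval_shift[of "iter (int n) c" "iter (int n) d"] nobr by blast
  have F_k: "F y = F (y - of_int k) + of_int k" for y
    using F_shift_int[of "y - of_int k" k] by simp
  show ?case
    unfolding concave_on_iff
  proof (intro conjI ballI allI impI)
    fix x y u v :: real
    assume xy: "x \<in> {c..d}" "y \<in> {c..d}" "0 \<le> u" "0 \<le> v" "u + v = 1"
    have "u * iter (int n) x + v * iter (int n) y \<le> iter (int n) (u *\<^sub>R x + v *\<^sub>R y)"
      using IH xy unfolding concave_on_iff by blast
    then have "F (u * iter (int n) x + v * iter (int n) y) \<le> iter (int (Suc n)) (u *\<^sub>R x + v *\<^sub>R y)"
      using iter_le_iff[of 1] by (simp add: iter_Suc add.commute[of 1])
    moreover have "u * F (iter (int n) x - of_int k) + v * F (iter (int n) y - of_int k)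
        \<le> F (u *\<^sub>R (iter (int n) x - of_int k) + v *\<^sub>R (iter (int n) y - of_int k))"
    proof -
      have "iter (int n) x - of_int k \<in> {a..a + 1}" "iter (int n) y - of_int k \<in> {a..a + 1}"
        using xy(1,2) by (intro subsetD[OF k]; simp)+
      then show ?thesis using F_concave xy(3-5) unfolding concave_on_iff by blast
    qed
    moreover have "u *\<^sub>R (iter (int n) x - of_int k) + v *\<^sub>R (iter (int n) y - of_int k)
        = u * iter (int n) x + v * iter (int n) y - of_int k"
    proof -
      have "u * of_int k + v * of_int k = of_int k" using xy(5) by (metis distrib_right mult_1)
      then show ?thesis by (simp add: algebra_simps)
    qed
    moreover have "u * F (iter (int n) x) + v * F (iter (int n) y)
        = u * F (iter (int n) x - of_int k) + v * F (iter (int n) y - of_int k) + of_int k"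
    proof -
      have "u * of_int k + v * of_int k = of_int k" using xy(5) by (metis distrib_right mult_1)
      then show ?thesis unfolding F_k[of "iter (int n) x"] F_k[of "iter (int n) y"] by (simp add: algebra_simps)
    qed
    ultimately show "u * iter (int (Suc n)) x + v * iter (int (Suc n)) y \<le> iter (int (Suc n)) (u *\<^sub>R x + v *\<^sub>R y)"
      using F_k[of "u * iter (int n) x + v * iter (int n) y"] iter_Suc[of "int n" x] iter_Suc[of "int n" y]
      by (simp add: add.commute[of 1])
  qed simp
qed

text \<open>The first \<open>l = n - 1\<close> iterates are concave and the last application of
  \<open>F\<close> makes the midpoint inequality strict.\<close>

lemma iter_not_affine:
  assumes strict: "strictly_concave_on {a..a + 1} F" and "0 < n" "c < d"
    and nobr: "\<And>j m. j < n \<Longrightarrow> \<not> (c < iter (- int j) a + of_int m \<and> iter (- int j) a + of_int m < d)"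
  shows "(iter (int n) c + iter (int n) d) / 2 < iter (int n) ((c + d) / 2)"
proof -
  obtain l where n: "n = Suc l" using \<open>0 < n\<close> gr0_conv_Suc by blast
  define x where "x = iter (int l) c"
  define y where "y = iter (int l) d"
  have "concave_on {c..d} (iter (int l))" by (rule concave_on_iter) (use nobr n in simp)
  then have "(1 - 1/2) * x + 1/2 * y \<le> iter (int l) ((1 - 1/2) *\<^sub>R c + (1/2) *\<^sub>R d)"
    unfolding x_def y_def by (rule concave_onD) (use \<open>c < d\<close> in auto)
  then have mid: "(x + y) / 2 \<le> iter (int l) ((c + d) / 2)" by (simp add: field_simps)
  have "x < y" using \<open>c < d\<close> by (simp add: x_def y_def)
  have "\<not> (x < a + of_int m \<and> a + of_int m < y)" for m :: int
  proof
    assume "x < a + of_int m \<and> a + of_int m < y"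
    then have "iter (- int l) x < iter (- int l) (a + of_int m)"
      "iter (- int l) (a + of_int m) < iter (- int l) y" by (simp_all only: iter_less_iff)
    then show False using nobr[of l m] n by (simp add: iter_shift x_def y_def)
  qed
  then obtain k :: int where k: "{x - of_int k..y - of_int k} \<subseteq> {a..a + 1}"
    using unit_interval_shift by blast
  have F_k: "F z = F (z - of_int k) + of_int k" for z
    using F_shift_int[of "z - of_int k" k] by simp
  have "1/2 * F (x - of_int k) + (1 - 1/2) * F (y - of_int k)
      < F (1/2 * (x - of_int k) + (1 - 1/2) * (y - of_int k))"
    by (rule strictly_concave_onD[OF strict]) (use k \<open>x < y\<close> in auto)
  moreover have "1/2 * (x - of_int k) + (1 - 1/2) * (y - of_int k) = (x + y) / 2 - of_int k"
    by (simp add: field_simps)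
  ultimately have "1/2 * F (x - of_int k) + (1 - 1/2) * F (y - of_int k) < F ((x + y) / 2 - of_int k)"
    by (simp only:)
  moreover have "1/2 * X + (1 - 1/2) * Y = (X + Y) / 2" for X Y :: real by simp
  ultimately have "(F (x - of_int k) + F (y - of_int k)) / 2 < F ((x + y) / 2 - of_int k)"
    by (simp only:)
  moreover have "(X + Y) / 2 < Z" if "(X' + Y') / 2 < Z'" "X = X' + of_int k" "Y = Y' + of_int k" "Z = Z' + of_int k"
    for X Y Z X' Y' Z' :: real using that by simp
  ultimately have "(F x + F y) / 2 < F ((x + y) / 2)" using F_k by blast
  also have "\<dots> \<le> F (iter (int l) ((c + d) / 2))" using mid iter_le_iff[of 1] by simp
  finally show ?thesis by (simp add: n iter_Suc add.commute[of 1] x_def y_def)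
qed

end

locale rational_concave_circle_map =
  rational_circle_map F f p q P r s + concave_lift F a K for F f p q P r s a K
begin

definition defect :: "real \<Rightarrow> real" where
  "defect x = iter (int q) x - x - of_int P"

lemma defect_signs:
  "0 < defect x \<longleftrightarrow> x + of_int P < iter (int q) x"
  "defect x < 0 \<longleftrightarrow> iter (int q) x < x + of_int P"
  "defect x = 0 \<longleftrightarrow> x \<in> per"
  by (auto simp: defect_def per_def)

lemma defect_step: "0 < defect (step i x) \<longleftrightarrow> 0 < defect x" "defect (step i x) < 0 \<longleftrightarrow> defect x < 0"
  by (simp_all add: defect_signs greater_step_iff less_step_iff)

lemma continuous_defect: "continuous_on A defect"
  unfolding defect_def by (intro continuous_intros continuous_iter)

definition break_free :: "real \<Rightarrow> real \<Rightarrow> bool" where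
  "break_free c d \<longleftrightarrow>
    (\<forall>j m. j < q \<longrightarrow> \<not> (c < iter (- int j) a + of_int m \<and> iter (- int j) a + of_int m < d))"

lemma concave_defect:
  assumes "break_free c d" shows "concave_on {c..d} defect"
proof -
  have "concave_on {c..d} (iter (int q))"
    by (rule concave_on_iter) (use assms in \<open>auto simp: break_free_def\<close>)
  then have conc: "u * iter (int q) x + v * iter (int q) y \<le> iter (int q) (u *\<^sub>R x + v *\<^sub>R y)"
    if "x \<in> {c..d}" "y \<in> {c..d}" "0 \<le> u" "0 \<le> v" "u + v = 1" for x y u v
    using that unfolding concave_on_iff by blast
  show ?thesis
    unfolding concave_on_iff
  proof (intro conjI ballI allI impI)
    fix x y u v :: real
    assume xy: "x \<in> {c..d}" "y \<in> {c..d}" "0 \<le> u" "0 \<le> v" "u + v = 1"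
    have "u * of_int P + v * of_int P = of_int P" using xy(5) by (metis distrib_right mult_1)
    then show "u * defect x + v * defect y \<le> defect (u *\<^sub>R x + v *\<^sub>R y)"
      using conc[OF xy] by (simp add: defect_def algebra_simps)
  qed simp
qed

text \<open>A concave function vanishing at both ends is nonnegative. If it is nonzero at one
  interior point, the chords from there to the ends make it positive throughout.\<close>

lemma per_dichotomy:
  assumes "break_free c d" "c < d" "c \<in> per" "d \<in> per"
  shows "(\<forall>x\<in>{c<..<d}. 0 < defect x) \<or> {c..d} \<subseteq> per"
proof (rule disjCI)
  assume "\<not> {c..d} \<subseteq> per"
  then obtain w where w: "w \<in> {c..d}" "w \<notin> per" by blast
  then have "c < w" "w < d" using assms by (auto simp: order.order_iff_strict)
  have zero: "defect c = 0" "defect d = 0" using assms by (simp_all add: defect_signs)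
  note three = concave_on_three_points[OF concave_defect[OF assms(1)]]
  have "0 \<le> (d - c) * defect w" using three[of c d w] w zero assms(2) by simp
  then have "0 < defect w" using assms(2) w(2) defect_signs(3)[of w] by (simp add: zero_le_mult_iff)
  show "\<forall>x\<in>{c<..<d}. 0 < defect x"
  proof
    fix x assume x: "x \<in> {c<..<d}"
    show "0 < defect x"
    proof (cases "x \<le> w")
      case True
      have "0 < (x - c) * defect w" using x \<open>0 < defect w\<close> by simp
      also have "\<dots> \<le> (w - c) * defect x" using three[of c w x] x w True zero by simp
      finally show ?thesis using \<open>c < w\<close> by (simp add: zero_less_mult_iff)
    next
      case False
      have "0 < (d - x) * defect w" using x \<open>0 < defect w\<close> by simp
      also have "\<dots> \<le> (d - w) * defect x" using three[of w d x] x w False zero by simp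
      finally show ?thesis using \<open>w < d\<close> by (simp add: zero_less_mult_iff)
    qed
  qed
qed

lemma strict_not_subset_per:
  assumes "strictly_concave_on {a..a + 1} F" "break_free c d" "c < d"
  shows "\<not> {c..d} \<subseteq> per"
proof
  assume sub: "{c..d} \<subseteq> per"
  have "(iter (int q) c + iter (int q) d) / 2 < iter (int q) ((c + d) / 2)"
    by (rule iter_not_affine) (use assms q_pos in \<open>auto simp: break_free_def\<close>)
  moreover have "c \<in> per" "d \<in> per" "(c + d) / 2 \<in> per" using sub assms(3) by auto
  ultimately show False unfolding per_def by (simp add: field_simps)
qed

text \<open>The dichotomy on \<open>[c, d]\<close> decides: positive interior yields a repelling
  \<open>c\<close> and an attracting \<open>d\<close>, a zero interval yields case (b).\<close>

lemma cases_break_free: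
  assumes "break_free c d" "c < d" "c \<in> per" "d \<in> per" "d \<le> step 1 c"
    and down: "\<And>x. x \<in> {d<..<step 1 c} \<Longrightarrow> defect x < 0"
  shows "(case_a f p q \<or> case_b f p q) \<and> (strictly_concave_on {a..a + 1} F \<longrightarrow> case_a f p q)"
proof -
  consider "\<forall>x\<in>{c<..<d}. 0 < defect x" | "{c..d} \<subseteq> per"
    using per_dichotomy[OF assms(1-4)] by blast
  then show ?thesis
  proof cases
    case 1
    have "case_a f p q"
      by (rule case_aI[OF assms(3,4)]) (use 1 assms in \<open>auto simp flip: defect_signs\<close>)
    then show ?thesis by blast
  next
    case 2
    have "case_b f p q"
      by (rule case_bI[OF assms(2,5) 2]) (use down in \<open>auto simp flip: defect_signs\<close>)
    then show ?thesis using strict_not_subset_per[OF _ assms(1,2)] 2 by blast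
  qed
qed

text \<open>All break points of \<open>F\<^sup>q\<close> are then step images of \<open>a\<close>,
  so none lies strictly between \<open>a\<close> and the next one.\<close>

lemma cases_break_periodic:
  assumes a: "a \<in> per"
  shows "(case_a f p q \<or> case_b f p q) \<and> (strictly_concave_on {a..a + 1} F \<longrightarrow> case_a f p q)"
proof (rule cases_break_free[where c = a and d = "step 1 a"])
  show "break_free a (step 1 a)"
    unfolding break_free_def
  proof (intro allI impI notI)
    fix j m assume "a < iter (- int j) a + of_int m \<and> iter (- int j) a + of_int m < step 1 a"
    then have "step 0 a < step (- int j * P + m * int q) a" "step (- int j * P + m * int q) a < step 1 a"
      unfolding per_orbit[OF a] by simp_all
    then show False unfolding step_index_less_iff[OF a] by linarith
  qed
qed (use a step_gt[OF a, of 1] in auto)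

text \<open>\<open>P\<close> is invertible modulo \<open>q\<close>, so the index determines
  \<open>j\<close> modulo \<open>q\<close>; hence each gap index belongs to at most one break
  point.\<close>

lemma index_unique:
  assumes "j < q" "j' < q" "- int j * P + m * int q = - int j' * P + m' * int q"
  shows "j = j'" "m = m'"
proof -
  have eq: "(int j - int j') * P = (m - m') * int q" using assms(3) by (simp add: algebra_simps)
  have "int j - int j' = (int j - int j') * (r * P + s * int q)" by (simp add: bezout)
  also have "\<dots> = r * ((int j - int j') * P) + (int j - int j') * s * int q" by (simp add: algebra_simps)
  also have "\<dots> = (r * (m - m') + (int j - int j') * s) * int q" unfolding eq by (simp add: algebra_simps)
  finally have "int q dvd int j - int j'" by (metis dvd_triv_right)
  then have "int j mod int q = int j' mod int q" by (simp add: mod_eq_dvd_iff)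
  then show "j = j'" using assms(1,2) by simp
  then show "m = m'" using eq q_pos by simp
qed

text \<open>Let \<open>(l, u)\<close> be the gap of \<open>per\<close> around \<open>a\<close>.
  Concavity between two consecutive break points rules out a positive defect at \<open>a\<close>, so
  the gap carries negative sign, and the break-free interval from \<open>u\<close> to
  \<open>step 1 l\<close> falls under the dichotomy.\<close>

lemma cases_break_nonperiodic:
  assumes a: "a \<notin> per"
  shows "(case_a f p q \<or> case_b f p q) \<and> (strictly_concave_on {a..a + 1} F \<longrightarrow> case_a f p q)"
proof -
  have closed: "closed per"
  proof -
    have "per = defect -` {0}" by (auto simp: defect_signs)
    then show ?thesis using continuous_closed_vimage[of "{0}" defect] continuous_defect[of UNIV]
      by (simp add: continuous_on_eq_continuous_at)
  qed
  obtain y where y: "y \<in> per" using per_nonempty by blast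
  have shift: "y + of_int k \<in> per" for k
    using step_q[OF y, of k] per_step_iff[of "k * int q" y] y by simp
  define l where "l = Sup (per \<inter> {..a})"
  define u where "u = Inf (per \<inter> {a..})"
  have "y + of_int \<lfloor>a - y\<rfloor> \<le> a" "a \<le> y + of_int \<lceil>a - y\<rceil>" by linarith+
  then have ne: "per \<inter> {..a} \<noteq> {}" "per \<inter> {a..} \<noteq> {}" using shift by blast+
  have bdd: "bdd_above (per \<inter> {..a})" "bdd_below (per \<inter> {a..})" by auto
  have "l \<in> per \<inter> {..a}" unfolding l_def
    by (rule closed_contains_Sup[OF ne(1) bdd(1)]) (intro closed_Int closed closed_atMost)
  then have l: "l \<in> per" "l < a" using a by (auto simp: order.order_iff_strict)
  have "u \<in> per \<inter> {a..}" unfolding u_def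
    by (rule closed_contains_Inf[OF ne(2) bdd(2)]) (intro closed_Int closed closed_atLeast)
  then have u: "u \<in> per" "a < u" using a by (auto simp: order.order_iff_strict)
  have gap: "x \<le> l \<or> u \<le> x" if "x \<in> per" for x
    using cSup_upper[OF _ bdd(1), of x] cInf_lower[OF _ bdd(2), of x] that
    unfolding l_def u_def by (cases "x \<le> a") auto
  have lu: "u \<le> step 1 l" using gap[of "step 1 l"] step_gt[OF l(1), of 1] l(1) by auto
  have lu': "step (- 1) u \<le> l" using lu step_le_iff[of "- 1" u "step 1 l"] step_uminus(2)[of 1 l] by simp

  \<comment> \<open>The solution of \<open>- j P + m q = 1\<close> with
    \<open>0 \<le> j < q\<close>, obtained from the Bezout coefficient \<open>r\<close> modulo
    \<open>q\<close>.\<close>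
  define j1 where "j1 = nat ((- r) mod int q)"
  define m1 where "m1 = s - ((- r) div int q) * P"
  have j1: "j1 < q" "int j1 = (- r) mod int q" using q_pos by (simp_all add: j1_def nat_less_iff)
  have jm1: "- int j1 * P + m1 * int q = 1"
  proof -
    define t where "t = (- r) div int q"
    have e: "int j1 = - r - int q * t" unfolding j1(2) t_def by (simp add: minus_mult_div_eq_mod)
    show ?thesis unfolding m1_def t_def[symmetric] e using bezout by (simp add: algebra_simps)
  qed
  \<comment> \<open>\<open>\<beta>\<close> is the only break point of \<open>F\<^sup>q\<close> in the gap next to \<open>(l, u)\<close>.\<close>
  define \<beta> where "\<beta> = iter (- int j1) a + of_int m1"
  \<comment> \<open>The break point with parameters \<open>j\<close>, \<open>m\<close> lies in the
    gap of index \<open>- j P + m q\<close>.\<close>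
  have break_between: "step (- int j * P + m * int q) l < iter (- int j) a + of_int m"
    "iter (- int j) a + of_int m < step (- int j * P + m * int q) u" for j m
    unfolding per_orbit[OF l(1), symmetric] per_orbit[OF u(1), symmetric] using l u by simp_all
  have \<beta>: "step 1 l < \<beta>" "\<beta> < step 1 u"
    using break_between[of j1 m1] unfolding jm1 \<beta>_def by simp_all
  have free: "break_free a \<beta>"
    unfolding break_free_def
  proof (intro allI impI notI)
    fix j m assume j: "j < q" and w: "a < iter (- int j) a + of_int m \<and> iter (- int j) a + of_int m < \<beta>"
    define i where "i = - int j * P + m * int q"
    have bt: "step i l < iter (- int j) a + of_int m" "iter (- int j) a + of_int m < step i u"
      using break_between[of j m] unfolding i_def by simp_all
    \<comment> \<open>Gaps of negative index lie left of \<open>a\<close>, those of index at least 2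
      lie right of \<open>\<beta>\<close>; indices 0 and 1 contain only \<open>a\<close> and
      \<open>\<beta>\<close> as break points.\<close>
    consider "i \<le> - 1" | "i = 0" | "i = 1" | "2 \<le> i" by linarith
    then show False
    proof cases
      case 1
      then have "step i u \<le> step (- 1) u" by (simp add: step_index_le_iff[OF u(1)])
      then show False using lu' bt w l(2) by linarith
    next
      case 2
      then have "j = 0" "m = 0"
        using index_unique[OF j q_pos, of m 0] unfolding i_def by simp_all
      then show False using w by simp
    next
      case 3
      then have "- int j * P + m * int q = - int j1 * P + m1 * int q" unfolding i_def jm1 .
      then have "j = j1" "m = m1" by (rule index_unique[OF j j1(1)])+
      then show False using w by (simp add: \<beta>_def)
    next
      case 4
      then have "step 2 l \<le> step i l" by (simp add: step_index_le_iff[OF l(1)])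
      moreover have "step 1 u \<le> step 2 l" using lu step_add[of 1 1 l] by simp
      ultimately show False using bt w \<beta> by linarith
    qed
  qed
  \<comment> \<open>The sign of the defect is constant along orbits, since iterates commute with
    \<open>F\<^sup>q\<close>.\<close>
  have sgn_\<beta>: "0 < defect \<beta>" if "0 < defect a"
  proof -
    have "a + of_int P < iter (int q) a" using that by (simp add: defect_signs)
    then have "iter (- int j1) (a + of_int P) < iter (- int j1) (iter (int q) a)" by (simp only: iter_less_iff)
    then have "iter (- int j1) a + of_int P < iter (int q) (iter (- int j1) a)"
      by (simp add: iter_shift add.commute flip: iter_add)
    then show ?thesis by (simp add: defect_signs \<beta>_def iter_shift)
  qed
  \<comment> \<open>Otherwise the defect is positive at \<open>a\<close> and \<open>\<beta>\<close>,
    hence by concavity also at \<open>u\<close> between them, where it vanishes.\<close>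
  have "defect a < 0"
  proof (rule ccontr)
    assume "\<not> defect a < 0"
    then have pos: "0 < defect a" using a defect_signs(3)[of a] by linarith
    have "u < \<beta>" using lu \<beta>(1) by simp
    have "(\<beta> - u) * defect a + (u - a) * defect \<beta> \<le> (\<beta> - a) * defect u"
      by (rule concave_on_three_points[OF concave_defect[OF free]]) (use \<open>u < \<beta>\<close> u in auto)
    moreover have "0 < (\<beta> - u) * defect a" "0 < (u - a) * defect \<beta>"
      using pos sgn_\<beta> \<open>u < \<beta>\<close> u by simp_all
    moreover have "defect u = 0" using u by (simp add: defect_signs)
    ultimately show False by simp
  qed
  have neg: "defect x < 0" if "l < x" "x < u" for x
  proof (rule ccontr)
    assume "\<not> defect x < 0"
    then have "0 \<le> defect x" by simp
    have "\<exists>z. l < z \<and> z < u \<and> defect z = 0"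
    proof (cases "x \<le> a")
      case True
      then obtain z where "x \<le> z" "z \<le> a" "defect z = 0"
        using IVT2'[of defect a 0 x] \<open>0 \<le> defect x\<close> \<open>defect a < 0\<close> continuous_defect by auto
      then show ?thesis using that u by (intro exI[of _ z]) auto
    next
      case False
      then obtain z where "a \<le> z" "z \<le> x" "defect z = 0"
        using IVT'[of defect a 0 x] \<open>0 \<le> defect x\<close> \<open>defect a < 0\<close> continuous_defect by auto
      then show ?thesis using that l by (intro exI[of _ z]) auto
    qed
    then show False using gap defect_signs(3) by (meson linorder_not_less)
  qed
  have down: "defect x < 0" if "x \<in> {step 1 l<..<step 1 u}" for x
  proof -
    have "step (- 1) (step 1 l) < step (- 1) x" "step (- 1) x < step (- 1) (step 1 u)"
      using that by (simp_all only: step_less_iff greaterThanLessThan_iff)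
    then have "defect (step (- 1) x) < 0" using neg step_uminus(2)[of 1] by simp
    then show ?thesis by (simp add: defect_step)
  qed
  show ?thesis
  \<comment> \<open>Equality means a single periodic orbit: attractor and repellor coincide.\<close>
  proof (cases "u = step 1 l")
    case True
    have "case_a f p q"
      by (rule case_aI[OF u(1) u(1)])
         (use down True step_gt[OF u(1), of 1] in \<open>auto simp flip: defect_signs\<close>)
    then show ?thesis by blast
  next
    case False
    show ?thesis
    proof (rule cases_break_free[where c = u and d = "step 1 l"])
      show "break_free u (step 1 l)"
        unfolding break_free_def
      proof (intro allI impI notI)
        fix j m assume "j < q"
          "u < iter (- int j) a + of_int m \<and> iter (- int j) a + of_int m < step 1 l"
        then show False using free \<beta>(1) u(2) unfolding break_free_def by (meson less_trans)
      qed
    qed (use False lu l u down in auto)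
  qed
qed

lemma rational_cases:
  "(case_a f p q \<or> case_b f p q) \<and> (strictly_concave_on {a..a + 1} F \<longrightarrow> case_a f p q)"
  using cases_break_periodic cases_break_nonperiodic by blast

end

section \<open>The wave billiard\<close>

locale wave_table =
  fixes b :: "real \<Rightarrow> real" and \<theta> db :: real
  assumes b_pos: "\<And>x. x \<in> {-1/2..1/2} \<Longrightarrow> 0 < b x"
    and b_even: "\<And>x. x \<in> {-1/2..1/2} \<Longrightarrow> b (- x) = b x"
    and b_concave: "concave_on {-1/2..1/2} b"
    and b_noninc: "\<And>x y. 0 \<le> x \<Longrightarrow> x \<le> y \<Longrightarrow> y \<le> 1/2 \<Longrightarrow> b y \<le> b x"
    and b_deriv: "(b has_real_derivative db) (at (-1/2) within {-1/2..1/2})"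
    and theta: "arctan db < \<theta>" "\<theta> < pi / 2"
begin

text \<open>For a concave function the one-sided derivative at the left end bounds every secant
  slope.\<close>

lemma secant_le:
  assumes "- 1/2 \<le> s" "s < t" "t \<le> 1/2"
  shows "b t - b s \<le> db * (t - s)"
proof -
  let ?F = "at (- 1/2) within {- 1/2..1/2::real}"
  have lim: "((\<lambda>w. (b w - b (- 1/2)) / (w - (- 1/2))) \<longlongrightarrow> db) ?F"
    using b_deriv by (simp add: has_field_derivative_iff)
  have nt: "?F \<noteq> bot" by (simp add: trivial_limit_within islimpt_Icc)
  \<comment> \<open>The chord from \<open>- 1/2\<close> to \<open>w\<close> is steeper, and
    \<open>w\<close> tends to \<open>- 1/2\<close>. If \<open>s = - 1/2\<close> the two chords share
    their left end and \<open>w < t\<close> suffices; otherwise \<open>w \<le> s\<close> places them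
    side by side.\<close>
  have "(b t - b s) / (t - s) \<le> (b w - b (- 1/2)) / (w - (- 1/2))"
    if w: "- 1/2 < w" "w < t" "s = - 1/2 \<or> w \<le> s" for w
  proof (cases "s = - 1/2")
    case True
    have "(- b s - - b w) / (s - w) \<le> (- b s - - b t) / (s - t)"
      by (rule convex_on_slope_le(1)[of "{- 1/2..1/2}"])
         (use b_concave True w assms in \<open>auto simp: concave_on_def\<close>)
    then have "- ((b s - b w) / (s - w)) \<le> - ((b s - b t) / (s - t))"
      by (simp add: minus_divide_left)
    then have "(b t - b s) / (t - s) \<le> (b w - b s) / (w - s)"
      by (metis minus_diff_eq minus_divide_divide neg_le_iff_le)
    then show ?thesis by (simp only: True)
  next
    case False
    then show ?thesis
      by (intro concave_on_slope_mono[OF b_concave]) (use w assms in auto)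
  qed
  moreover have "\<forall>\<^sub>F w in ?F. - 1/2 < w \<and> w < t \<and> (s = - 1/2 \<or> w \<le> s)"
    unfolding eventually_at
    by (rule exI[of _ "if s = - 1/2 then t - s else s + 1/2"])
       (use assms in \<open>auto simp: dist_real_def\<close>)
  ultimately have "\<forall>\<^sub>F w in ?F. (b t - b s) / (t - s) \<le> (b w - b (- 1/2)) / (w - (- 1/2))"
    by (auto elim: eventually_mono)
  then have "(b t - b s) / (t - s) \<le> db" by (rule tendsto_lowerbound[OF lim _ nt])
  then show ?thesis using assms by (simp add: divide_le_eq)
qed

lemma db_nonneg: "0 \<le> db"
  using secant_le[of "- 1/2" 0] b_noninc[of 0 "1/2"] b_even[of "1/2"] by simp

lemma theta_pos: "0 < \<theta>"
  using db_nonneg theta(1) by (smt (verit) zero_le_arctan_iff)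

lemma sin_pos: "0 < sin \<theta>" and cos_pos: "0 < cos \<theta>"
  using theta_pos theta(2) by (auto intro!: sin_gt_zero cos_gt_zero_pi)

text \<open>The Lipschitz constant of \<open>B cot \<theta>\<close>; the angle condition makes it
  less than 1.\<close>

definition \<kappa> :: real where "\<kappa> = db * cos \<theta> / sin \<theta>"

lemma \<kappa>_nonneg: "0 \<le> \<kappa>"
  using db_nonneg sin_pos cos_pos by (simp add: \<kappa>_def)

lemma \<kappa>_less_1: "\<kappa> < 1"
proof -
  have "tan (arctan db) < tan \<theta>"
    using theta arctan_lbound[of db] by (intro tan_monotone) auto
  then have "db < sin \<theta> / cos \<theta>" by (simp only: tan_arctan) (simp add: tan_def)
  then show ?thesis using sin_pos cos_pos by (simp add: \<kappa>_def field_simps)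
qed

abbreviation B :: "real \<Rightarrow> real" where "B \<equiv> per_ext b"

lemma B_eq: "B x = b \<bar>x - of_int (round x)\<bar>"
proof -
  have "\<bar>of_int (round x) - x\<bar> \<le> 1/2" by (rule of_int_round_abs_le)
  then have "x - of_int (round x) \<in> {-1/2..1/2}" unfolding atLeastAtMost_iff by linarith
  then show ?thesis
    using b_even[of "x - of_int (round x)"] by (auto simp: per_ext_def round_def abs_if)
qed

lemma B_pos: "0 < B x"
proof -
  have "\<bar>of_int (round x) - x\<bar> \<le> 1/2" by (rule of_int_round_abs_le)
  then show ?thesis unfolding B_eq by (intro b_pos) (auto simp: abs_minus_commute)
qed

lemma B_shift: "B (x + 1) = B x"
proof -
  have "\<lfloor>x + 1 + 1/2\<rfloor> = \<lfloor>x + 1/2\<rfloor> + 1" by linarith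
  then show ?thesis by (simp add: per_ext_def)
qed

lemma B_eq_b: "B x = b x" if "x \<in> {-1/2..1/2}"
proof (cases "x = 1/2")
  case True
  then show ?thesis using b_even[of "1/2"] unfolding True per_ext_def by simp
next
  case False
  then have "\<lfloor>x + 1/2\<rfloor> = 0" using that by (simp add: floor_eq_iff)
  then show ?thesis by (simp add: per_ext_def)
qed

text \<open>By evenness \<open>B\<close> is a function of the distance to the nearest integer, which
  is 1-Lipschitz. On \<open>[0, 1/2]\<close> the bound is \<open>secant_le\<close> reflected to the
  left half.\<close>

lemma B_Lipschitz: "\<bar>B x - B y\<bar> \<le> db * \<bar>x - y\<bar>"
proof -
  define d where "d x = \<bar>x - of_int (round x)\<bar>" for x :: real
  have d_bounds: "0 \<le> d x" "d x \<le> 1/2" for x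
    using of_int_round_abs_le[of x] by (simp_all add: d_def abs_minus_commute)
  have "d x \<le> d y + \<bar>x - y\<bar>" for x y
  proof -
    have "d x \<le> \<bar>x - of_int (round y)\<bar>" unfolding d_def by (rule round_diff_minimal)
    then show ?thesis by (simp add: d_def)
  qed
  from this[of x y] this[of y x] have d: "\<bar>d x - d y\<bar> \<le> \<bar>x - y\<bar>" by linarith
  have b: "\<bar>b u - b v\<bar> \<le> db * (v - u)" if uv: "0 \<le> u" "u \<le> v" "v \<le> 1/2" for u v
  proof (cases "u = v")
    case False
    then have "b (- u) - b (- v) \<le> db * (- u - - v)" using uv by (intro secant_le) auto
    then show ?thesis using b_noninc[OF uv] b_even[of u] b_even[of v] uv by simp
  qed simp
  have "\<bar>b (d x) - b (d y)\<bar> \<le> db * \<bar>d x - d y\<bar>"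
    using b[of "d x" "d y"] b[of "d y" "d x"] d_bounds
    by (cases "d x \<le> d y") (auto simp: abs_minus_commute)
  also have "\<dots> \<le> db * \<bar>x - y\<bar>" using d db_nonneg by (rule mult_left_mono)
  finally show ?thesis by (simp add: B_eq d_def)
qed

text \<open>The flow line through the upper boundary point of abscissa X left the cross-section at
  \<open>dep X\<close> and next returns to it at \<open>arr X\<close>.\<close>

definition dep :: "real \<Rightarrow> real" where "dep X = X - B X * cos \<theta> / sin \<theta>"
definition arr :: "real \<Rightarrow> real" where "arr X = X + B X * cos \<theta> / sin \<theta>"

lemma B_cot_Lipschitz:
  assumes "X \<le> Y"
  shows "\<bar>B Y * cos \<theta> / sin \<theta> - B X * cos \<theta> / sin \<theta>\<bar> \<le> \<kappa> * (Y - X)"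
proof -
  have "B Y * cos \<theta> / sin \<theta> - B X * cos \<theta> / sin \<theta> = (B Y - B X) * (cos \<theta> / sin \<theta>)"
    by (simp add: left_diff_distrib diff_divide_distrib)
  then have "\<bar>B Y * cos \<theta> / sin \<theta> - B X * cos \<theta> / sin \<theta>\<bar> = \<bar>B Y - B X\<bar> * (cos \<theta> / sin \<theta>)"
    using sin_pos cos_pos by (simp add: abs_mult)
  also have "\<dots> \<le> (db * \<bar>Y - X\<bar>) * (cos \<theta> / sin \<theta>)"
    using sin_pos cos_pos by (intro mult_right_mono B_Lipschitz) auto
  finally show ?thesis using assms by (simp add: \<kappa>_def field_simps)
qed

lemma dep_diff:
  assumes "X \<le> Y"
  shows "(1 - \<kappa>) * (Y - X) \<le> dep Y - dep X" "dep Y - dep X \<le> (1 + \<kappa>) * (Y - X)"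
  using B_cot_Lipschitz[OF assms] by (simp_all add: dep_def algebra_simps abs_le_iff)

lemma arr_diff:
  assumes "X \<le> Y"
  shows "(1 - \<kappa>) * (Y - X) \<le> arr Y - arr X" "arr Y - arr X \<le> (1 + \<kappa>) * (Y - X)"
  using B_cot_Lipschitz[OF assms] by (simp_all add: arr_def algebra_simps abs_le_iff)

lemma dep_less_iff: "dep X < dep Y \<longleftrightarrow> X < Y"
proof -
  have "dep X < dep Y" if "X < Y" for X Y
  proof -
    have "0 < (1 - \<kappa>) * (Y - X)" using that \<kappa>_less_1 by simp
    then show ?thesis using dep_diff(1)[of X Y] that by simp
  qed
  then show ?thesis by (metis less_asym less_irrefl linorder_cases)
qed

lemma arr_less_iff: "arr X < arr Y \<longleftrightarrow> X < Y"
proof -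
  have "arr X < arr Y" if "X < Y" for X Y
  proof -
    have "0 < (1 - \<kappa>) * (Y - X)" using that \<kappa>_less_1 by simp
    then show ?thesis using arr_diff(1)[of X Y] that by simp
  qed
  then show ?thesis by (metis less_asym less_irrefl linorder_cases)
qed

lemma dep_le_iff: "dep X \<le> dep Y \<longleftrightarrow> X \<le> Y"
  by (meson dep_less_iff linorder_not_less)

lemma arr_le_iff: "arr X \<le> arr Y \<longleftrightarrow> X \<le> Y"
  by (meson arr_less_iff linorder_not_less)

lemma dep_shift: "dep (X + 1) = dep X + 1" and arr_shift: "arr (X + 1) = arr X + 1"
  by (simp_all add: dep_def arr_def B_shift)

lemma continuous_B: "continuous_on A B"
proof -
  have "db-lipschitz_on A B"
    using B_Lipschitz db_nonneg by (intro lipschitz_onI) (auto simp: dist_real_def)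
  then show ?thesis by (rule lipschitz_on_continuous_on)
qed

lemma range_dep: "range dep = UNIV" and range_arr: "range arr = UNIV"
proof -
  have surj: "range g = UNIV"
    if cont: "continuous_on UNIV g" and grow: "\<And>X Y. X \<le> Y \<Longrightarrow> (1 - \<kappa>) * (Y - X) \<le> g Y - g X"
    for g :: "real \<Rightarrow> real"
  proof -
    have "y \<in> range g" for y
    proof -
      define R where "R = \<bar>y - g 0\<bar> / (1 - \<kappa>)"
      have R: "0 \<le> R" "(1 - \<kappa>) * R = \<bar>y - g 0\<bar>" using \<kappa>_less_1 by (simp_all add: R_def)
      have "g (- R) \<le> y" "y \<le> g R" using grow[of "- R" 0] grow[of 0 R] R by auto
      then show ?thesis
        using IVT'[of g "- R" y R] R(1) continuous_on_subset[OF cont] by auto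
    qed
    then show ?thesis by blast
  qed
  show "range dep = UNIV"
    by (rule surj) (use dep_diff(1) sin_pos in \<open>auto simp: dep_def[abs_def] intro!: continuous_intros continuous_B\<close>)
  show "range arr = UNIV"
    by (rule surj) (use arr_diff(1) sin_pos in \<open>auto simp: arr_def[abs_def] intro!: continuous_intros continuous_B\<close>)
qed

lemma dep_cases: obtains X where "x = dep X"
  using range_dep by (metis UNIV_I imageE)

text \<open>Multiplied by \<open>cot \<theta>\<close>, being on or above the boundary at
  \<open>Y\<close> becomes \<open>dep X \<le> dep Y\<close>. Monotonicity of \<open>dep\<close>
  shows that the line crosses the boundary just once.\<close>

lemma hit_time_dep: "hit_time b \<theta> (dep X) = B X / sin \<theta>"
proof -
  have "B (dep X + t * cos \<theta>) \<le> t * sin \<theta> \<longleftrightarrow> B X / sin \<theta> \<le> t" for t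
  proof -
    define Y where "Y = dep X + t * cos \<theta>"
    have "B Y \<le> t * sin \<theta> \<longleftrightarrow> B Y * (cos \<theta> / sin \<theta>) \<le> t * sin \<theta> * (cos \<theta> / sin \<theta>)"
      using sin_pos cos_pos by (subst mult_le_cancel_right_pos) auto
    also have "t * sin \<theta> * (cos \<theta> / sin \<theta>) = t * cos \<theta>" using sin_pos by simp
    also have "B Y * (cos \<theta> / sin \<theta>) \<le> t * cos \<theta> \<longleftrightarrow> dep X \<le> dep Y"
      unfolding dep_def[of Y] by (simp add: Y_def)
    also have "\<dots> \<longleftrightarrow> B X / sin \<theta> * cos \<theta> \<le> t * cos \<theta>"
      unfolding dep_le_iff by (simp add: Y_def dep_def)
    also have "\<dots> \<longleftrightarrow> B X / sin \<theta> \<le> t" using cos_pos by (rule mult_le_cancel_right_pos)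
    finally show ?thesis by (simp add: Y_def)
  qed
  moreover have "0 < B X / sin \<theta>" using B_pos sin_pos by simp
  ultimately have "{t. 0 \<le> t \<and> B (dep X + t * cos \<theta>) \<le> t * sin \<theta>} = {B X / sin \<theta>..}"
    by auto
  then show ?thesis by (simp add: hit_time_def)
qed

lemma wave_lift_dep: "wave_lift b \<theta> (dep X) = arr X"
proof -
  have "dep X + hit_time b \<theta> (dep X) * cos \<theta> = X"
    unfolding hit_time_dep by (simp add: dep_def)
  then show ?thesis by (simp add: wave_lift_def arr_def)
qed

lemma circle_lift_wave: "circle_lift (wave_lift b \<theta>)"
proof
  show "strict_mono (wave_lift b \<theta>)"
  proof
    fix x y :: real assume "x < y"
    obtain X Y where "x = dep X" "y = dep Y" by (meson dep_cases)
    then show "wave_lift b \<theta> x < wave_lift b \<theta> y"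
      using \<open>x < y\<close> by (simp add: wave_lift_dep dep_less_iff arr_less_iff)
  qed
  show "surj (wave_lift b \<theta>)"
  proof (rule surjI)
    fix y
    have "arr (inv arr y) = y" using range_arr by (rule surj_f_inv_f)
    then show "wave_lift b \<theta> (dep (inv arr y)) = y" by (simp add: wave_lift_dep)
  qed
  fix x
  obtain X where "x = dep X" by (rule dep_cases)
  then show "wave_lift b \<theta> (x + 1) = wave_lift b \<theta> x + 1"
    by (simp add: wave_lift_dep arr_shift flip: dep_shift)
qed

lemma dep_unit_cases:
  assumes "x \<in> {dep (-1/2)..dep (-1/2) + 1}"
  obtains X where "x = dep X" "X \<in> {-1/2..1/2}"
proof -
  obtain X where X: "x = dep X" by (rule dep_cases)
  have "dep (-1/2) + 1 = dep (1/2)" using dep_shift[of "-1/2"] by simp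
  then have "X \<in> {-1/2..1/2}" using assms unfolding X by (simp add: dep_le_iff)
  then show ?thesis using X that by blast
qed

lemma dep_convex_comb:
  "dep (u * X + v * Y) = u * dep X + v * dep Y + (u * B X + v * B Y - B (u * X + v * Y)) * (cos \<theta> / sin \<theta>)"
  "arr (u * X + v * Y) = u * arr X + v * arr Y - (u * B X + v * B Y - B (u * X + v * Y)) * (cos \<theta> / sin \<theta>)"
  by (simp_all add: dep_def arr_def algebra_simps)

lemma convex_comb_unit:
  fixes u v :: real
  assumes "X \<in> {-1/2..1/2}" "Y \<in> {-1/2..1/2}" "0 \<le> u" "0 \<le> v" "u + v = 1"
  shows "u * X + v * Y \<in> {-1/2..1/2}"
  using convexD[OF convex_real_interval(5), of X "-1/2" "1/2" Y u v] assms by simp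

text \<open>The lift is \<open>arr\<close> after the inverse of \<open>dep\<close>: an increasing
  concave function after the inverse of an increasing convex one. Concretely, convexity of
  \<open>dep\<close> places the combination \<open>V\<close> left of \<open>W\<close>, and concavity
  of \<open>arr\<close> does the rest.\<close>

lemma wave_lift_concave: "concave_on {dep (-1/2)..dep (-1/2) + 1} (wave_lift b \<theta>)"
  unfolding concave_on_iff
proof (intro conjI ballI allI impI)
  fix x y u v :: real
  assume *: "x \<in> {dep (-1/2)..dep (-1/2) + 1}" "y \<in> {dep (-1/2)..dep (-1/2) + 1}"
    and uv: "0 \<le> u" "0 \<le> v" "u + v = 1"
  obtain X where X: "x = dep X" "X \<in> {-1/2..1/2}" by (rule dep_unit_cases[OF *(1)])
  obtain Y where Y: "y = dep Y" "Y \<in> {-1/2..1/2}" by (rule dep_unit_cases[OF *(2)])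
  obtain W where W: "u * x + v * y = dep W" by (rule dep_cases)
  define V where "V = u * X + v * Y"
  have "u * b X + v * b Y \<le> b (u *\<^sub>R X + v *\<^sub>R Y)"
    using b_concave X(2) Y(2) uv unfolding concave_on_iff by blast
  then have "u * B X + v * B Y - B V \<le> 0"
    using convex_comb_unit[OF X(2) Y(2) uv] X(2) Y(2) by (simp add: B_eq_b V_def)
  then have "(u * B X + v * B Y - B V) * (cos \<theta> / sin \<theta>) \<le> 0"
    using sin_pos cos_pos by (simp add: mult_le_0_iff divide_nonpos_pos)
  then have V: "dep V \<le> dep W" "u * arr X + v * arr Y \<le> arr V"
    using dep_convex_comb[of u X v Y] W unfolding V_def[symmetric] X(1) Y(1) by linarith+
  then have "u * arr X + v * arr Y \<le> arr W" unfolding dep_le_iff using arr_le_iff[of V W] by simp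
  then show "u * wave_lift b \<theta> x + v * wave_lift b \<theta> y \<le> wave_lift b \<theta> (u *\<^sub>R x + v *\<^sub>R y)"
    using W by (simp add: X(1) Y(1) wave_lift_dep)
qed simp

lemma wave_lift_strictly_concave:
  assumes "strictly_concave_on {-1/2..1/2} b"
  shows "strictly_concave_on {dep (-1/2)..dep (-1/2) + 1} (wave_lift b \<theta>)"
  unfolding strictly_concave_on_def
proof (intro ballI allI impI)
  fix x y t :: real
  assume *: "x \<in> {dep (-1/2)..dep (-1/2) + 1}" "y \<in> {dep (-1/2)..dep (-1/2) + 1}"
    and t: "x \<noteq> y \<and> 0 < t \<and> t < 1"
  obtain X where X: "x = dep X" "X \<in> {-1/2..1/2}" by (rule dep_unit_cases[OF *(1)])
  obtain Y where Y: "y = dep Y" "Y \<in> {-1/2..1/2}" by (rule dep_unit_cases[OF *(2)])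
  obtain W where W: "t * x + (1 - t) * y = dep W" by (rule dep_cases)
  define V where "V = t * X + (1 - t) * Y"
  have "t * b X + (1 - t) * b Y < b V"
    unfolding V_def by (rule strictly_concave_onD[OF assms X(2) Y(2)]) (use t X Y in auto)
  then have "t * B X + (1 - t) * B Y - B V < 0"
    using convex_comb_unit[OF X(2) Y(2), of t "1 - t"] t X(2) Y(2) by (simp add: B_eq_b V_def)
  then have "(t * B X + (1 - t) * B Y - B V) * (cos \<theta> / sin \<theta>) < 0"
    using sin_pos cos_pos by (intro mult_neg_pos) auto
  then have V: "dep V < dep W" "t * arr X + (1 - t) * arr Y < arr V"
    using dep_convex_comb[of t X "1 - t" Y] W unfolding V_def[symmetric] X(1) Y(1) by linarith+
  then have "t * arr X + (1 - t) * arr Y < arr W" unfolding dep_less_iff using arr_less_iff[of V W] by simp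
  then show "t * wave_lift b \<theta> x + (1 - t) * wave_lift b \<theta> y < wave_lift b \<theta> (t * x + (1 - t) * y)"
    unfolding W by (simp add: X(1) Y(1) wave_lift_dep)
qed

text \<open>The break point is the departure point of the line through the corner
  \<open>- 1/2\<close>. The constant is the quotient of the upper and lower slope bounds of
  \<open>dep\<close> and \<open>arr\<close>.\<close>

sublocale concave_circle_map "wave_lift b \<theta>" "wave_map b \<theta>" "dep (-1/2)" "(1 + \<kappa>) / (1 - \<kappa>)"
proof -
  interpret circle_lift "wave_lift b \<theta>" by (rule circle_lift_wave)
  show "concave_circle_map (wave_lift b \<theta>) (wave_map b \<theta>) (dep (-1/2)) ((1 + \<kappa>) / (1 - \<kappa>))"
  proof
    fix x
    obtain m :: int where "Arg (circ x) / (2 * pi) = x + of_int m"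
      using circ_Arg[OF circ_in_Tcirc, of x] by (auto simp: circ_eq_iff)
    then show "wave_map b \<theta> (circ x) = circ (wave_lift b \<theta> x)"
      by (simp add: wave_map_def F_shift_int)
  next
    show "0 < (1 + \<kappa>) / (1 - \<kappa>)" using \<kappa>_nonneg \<kappa>_less_1 by simp
  next
    fix x y :: real assume "x < y"
    obtain X Y where XY: "x = dep X" "y = dep Y" by (meson dep_cases)
    have "X \<le> Y" using \<open>x < y\<close> by (simp add: XY dep_less_iff)
    have "(y - x) * (1 - \<kappa>) \<le> (1 + \<kappa>) * (Y - X) * (1 - \<kappa>)"
      using dep_diff(2)[OF \<open>X \<le> Y\<close>] \<kappa>_less_1 XY by (intro mult_right_mono) auto
    also have "\<dots> = (1 + \<kappa>) * ((1 - \<kappa>) * (Y - X))" by simp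
    also have "\<dots> \<le> (1 + \<kappa>) * (arr Y - arr X)"
      using arr_diff(1)[OF \<open>X \<le> Y\<close>] \<kappa>_nonneg by (intro mult_left_mono) auto
    finally show "(y - x) / ((1 + \<kappa>) / (1 - \<kappa>)) \<le> wave_lift b \<theta> y - wave_lift b \<theta> x"
      using \<kappa>_nonneg \<kappa>_less_1 by (simp add: XY wave_lift_dep divide_le_eq mult.commute)
    have "(arr Y - arr X) * (1 - \<kappa>) \<le> (1 + \<kappa>) * (Y - X) * (1 - \<kappa>)"
      using arr_diff(2)[OF \<open>X \<le> Y\<close>] \<kappa>_less_1 by (intro mult_right_mono) auto
    also have "\<dots> = (1 + \<kappa>) * ((1 - \<kappa>) * (Y - X))" by simp
    also have "\<dots> \<le> (1 + \<kappa>) * (y - x)"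
      using dep_diff(1)[OF \<open>X \<le> Y\<close>] \<kappa>_nonneg XY by (intro mult_left_mono) auto
    finally show "wave_lift b \<theta> y - wave_lift b \<theta> x \<le> (1 + \<kappa>) / (1 - \<kappa>) * (y - x)"
      using \<kappa>_less_1 by (simp add: XY wave_lift_dep le_divide_eq mult.commute)
  next
    show "concave_on {dep (-1/2)..dep (-1/2) + 1} (wave_lift b \<theta>)" by (rule wave_lift_concave)
  qed
qed

lemma rot_num_eq: "rot_num (wave_lift b \<theta>) = frac trans_num"
  by (simp add: rot_num_def trans_num_def)

lemma rational_rotation_number:
  assumes "0 < q" "coprime p q" "frac trans_num = real p / real q"
  shows "(case_a (wave_map b \<theta>) p q \<or> case_b (wave_map b \<theta>) p q) \<and>
    (strictly_concave_on {-1/2..1/2} b \<longrightarrow> case_a (wave_map b \<theta>) p q)"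
proof -
  \<comment> \<open>Restores the integer part of the translation number; adding a multiple of
    \<open>q\<close> preserves coprimality and the residue of \<open>p\<close>.\<close>
  define P where "P = int p + \<lfloor>trans_num\<rfloor> * int q"
  have "gcd P (int q) = 1"
  proof -
    have "gcd P (int q) = gcd (int q) (\<lfloor>trans_num\<rfloor> * int q + int p)"
      by (simp add: P_def gcd.commute add.commute)
    also have "\<dots> = gcd (int q) (int p)" by (rule gcd_add_mult)
    also have "\<dots> = 1" using assms(2) by (simp add: gcd.commute)
    finally show ?thesis .
  qed
  then obtain r s where rs: "r * P + s * int q = 1" using bezout_int by metis
  have "trans_num = real p / real q + of_int \<lfloor>trans_num\<rfloor>" using assms(3) by (simp add: frac_def)
  then have "real q * trans_num = real q * (real p / real q + of_int \<lfloor>trans_num\<rfloor>)" by simp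
  then have tn: "real q * trans_num = of_int P"
    using assms(1) by (simp add: P_def distrib_left)
  interpret rational_concave_circle_map "wave_lift b \<theta>" "wave_map b \<theta>" p q P r s "dep (-1/2)" "(1 + \<kappa>) / (1 - \<kappa>)"
    by unfold_locales (use assms(1) tn rs in \<open>auto simp: P_def\<close>)
  show ?thesis using rational_cases wave_lift_strictly_concave by blast
qed

end

theorem theorem2p2:
  fixes b :: "real \<Rightarrow> real" and \<theta> db :: real
  assumes b_pos: "\<forall>x\<in>{-1/2..1/2}. 0 < b x"
    and b_even: "\<forall>x\<in>{-1/2..1/2}. b (- x) = b x"
    and b_C1: "b piecewise_C1_differentiable_on {-1/2..1/2}"
    and b_concave: "concave_on {-1/2..1/2} b"
    and b_noninc: "\<forall>x y. 0 \<le> x \<and> x \<le> y \<and> y \<le> 1/2 \<longrightarrow> b y \<le> b x"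
    and b_deriv: "(b has_real_derivative db) (at (-1/2) within {-1/2..1/2})"
    and theta: "arctan db < \<theta>" "\<theta> < pi / 2"
  defines "f \<equiv> wave_map b \<theta>"
    and "\<rho> \<equiv> rot_num (wave_lift b \<theta>)"
  shows
    "(\<rho> \<notin> \<rat> \<longrightarrow>
        (\<exists>h h'. homeomorphism Tcirc Tcirc h h' \<and>
                (\<forall>z\<in>Tcirc. h (f z) = cis (2 * pi * \<rho>) * h z)) \<and>
        (\<forall>z\<in>Tcirc. closure (full_orbit f z) = Tcirc))
     \<and>
     (\<forall>p q :: nat. \<rho> \<in> \<rat> \<and>
        ((0 < \<rho> \<and> 0 < p \<and> 0 < q \<and> coprime p q \<and> \<rho> = real p / real q) \<or>
         (\<rho> = 0 \<and> p = 0 \<and> q = 1)) \<longrightarrow>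
        (case_a f p q \<or> case_b f p q) \<and>
        (strictly_concave_on {-1/2..1/2} b \<longrightarrow> case_a f p q))"
proof -
  interpret wave_table b \<theta> db
    by unfold_locales (use assms in auto)
  have \<rho>: "\<rho> = trans_num - of_int \<lfloor>trans_num\<rfloor>" by (simp add: \<rho>_def rot_num_eq frac_def)
  have irr: "trans_num \<notin> \<rat>" if "\<rho> \<notin> \<rat>"
    using that unfolding \<rho> by (metis Rats_diff Rats_of_int)
  have "cis (2 * pi * \<rho>) = circ trans_num"
    unfolding circ_def[symmetric] \<rho> by simp
  then have i: "\<rho> \<notin> \<rat> \<longrightarrow>
      (\<exists>h h'. homeomorphism Tcirc Tcirc h h' \<and> (\<forall>z\<in>Tcirc. h (f z) = cis (2 * pi * \<rho>) * h z)) \<and>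
      (\<forall>z\<in>Tcirc. closure (full_orbit f z) = Tcirc)"
    using circle_conjugate_to_rotation[OF irr] orbits_dense[OF irr] by (simp add: f_def)
  have "(case_a f p q \<or> case_b f p q) \<and> (strictly_concave_on {-1/2..1/2} b \<longrightarrow> case_a f p q)"
    if pq: "(0 < \<rho> \<and> 0 < p \<and> 0 < q \<and> coprime p q \<and> \<rho> = real p / real q) \<or> (\<rho> = 0 \<and> p = 0 \<and> q = 1)"
    for p q :: nat
    unfolding f_def
    by (rule rational_rotation_number) (use pq in \<open>auto simp: \<rho>_def rot_num_eq\<close>)
  with i show ?thesis by blast
qed

end
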